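(* Let $G=\langle f,g\rangle$ be a nearly abelian transcendental semigroup generated by two transcendental entire functions $f$ and $g$ such that $\operatorname{Sing}(f^{-1})$ and $\operatorname{Sing}(g^{-1})$ are bounded. Then $J(G)=J(f)=J(g)$.
   Context: A transcendental semigroup $G=\langle f_1,f_2,\ldots\rangle$ is the semigroup, under composition, generated by a family of transcendental entire functions. The Fatou set $F(G)$ is the largest open subset of $\mathbb{C}$ on which the family of functions in $G$ is normal (every sequence has a subsequence converging locally uniformly to a holomorphic function or to $\infty$); the Julia set $J(G)$ is the complement of $F(G)$ in the extended plane. For a single entire function $f$, $F(f)$ is the largest open subset of $\mathbb{C}$ on which the iterates $\{f^n\}_{n\ge1}$ form a normal family, and $J(f)$ is its complement (with the same convention regarding $\infty$). A transcendental semigroup $G$ is nearly abelian if there is a precompact family $\Phi$ of affine maps $z\mapsto az+b$ ($a\neq 0$), precompact in the space of affine maps with locally uniform convergence, such that (1) $\phi(F(G))=F(G)$ for every $\phi\in\Phi$; and (2) for every $f,g\in G$ there exists $\phi\in\Phi$ with $f\circ g=\phi\circ g\circ f$. For an entire function $f$, $\operatorname{Sing}(f^{-1})$ denotes the set of critical values and (finite) asymptotic values of $f$ together with their finite limit points. *)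

theory Defs
  imports "HOL-Complex_Analysis.Complex_Analysis"
begin

definition transcendental_entire :: "(complex \<Rightarrow> complex) \<Rightarrow> bool" where
  "transcendental_entire f \<longleftrightarrow> f holomorphic_on UNIV \<and> \<not> (\<exists>p. \<forall>z. f z = poly p z)"

inductive_set generated_semigroup :: "(complex \<Rightarrow> complex) set \<Rightarrow> (complex \<Rightarrow> complex) set"
  for S where
  generator: "f \<in> S \<Longrightarrow> f \<in> generated_semigroup S"
| comp: "f \<in> generated_semigroup S \<Longrightarrow> g \<in> generated_semigroup S \<Longrightarrow> f \<circ> g \<in> generated_semigroup S"

definition loc_unif_converges ::
    "(nat \<Rightarrow> complex \<Rightarrow> complex) \<Rightarrow> (complex \<Rightarrow> complex) \<Rightarrow> complex set \<Rightarrow> bool" where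
  "loc_unif_converges s h U \<longleftrightarrow>
     (\<forall>K. compact K \<and> K \<subseteq> U \<longrightarrow> uniform_limit K s h sequentially)"

definition loc_unif_converges_infinity :: "(nat \<Rightarrow> complex \<Rightarrow> complex) \<Rightarrow> complex set \<Rightarrow> bool" where
  "loc_unif_converges_infinity s U \<longleftrightarrow>
     (\<forall>K. compact K \<and> K \<subseteq> U \<longrightarrow> (\<forall>B. \<forall>\<^sub>F n in sequentially. \<forall>z\<in>K. B < norm (s n z)))"

text \<open>The limit of a locally uniformly (in the spherical metric) convergent sequence of holomorphic
  functions is, on each connected component of the open set, either holomorphic or identically
  infinity; different components may behave differently. With this reading normality is a local
  property.\<close>

definition normal_family_on :: "(complex \<Rightarrow> complex) set \<Rightarrow> complex set \<Rightarrow> bool" where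
  "normal_family_on \<F> U \<longleftrightarrow>
     (\<forall>s :: nat \<Rightarrow> complex \<Rightarrow> complex. range s \<subseteq> \<F> \<longrightarrow>
        (\<exists>r :: nat \<Rightarrow> nat. strict_mono r \<and>
           (\<forall>C \<in> components U.
              (\<exists>h. h holomorphic_on C \<and> loc_unif_converges (s \<circ> r) h C) \<or>
              loc_unif_converges_infinity (s \<circ> r) C)))"

text \<open>As normality is local, a union of open sets on which a family is normal is again such a set
  (by a diagonal argument), so the union below is the largest one.\<close>

definition fatou_set :: "(complex \<Rightarrow> complex) set \<Rightarrow> complex set" where
  "fatou_set \<F> = \<Union>{U. open U \<and> normal_family_on \<F> U}"

text \<open>The extended plane is the type \<open>complex option\<close>, with \<open>None\<close> as the point at infinity.\<close>

definition julia_set :: "(complex \<Rightarrow> complex) set \<Rightarrow> complex option set" where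
  "julia_set \<F> = UNIV - Some ` fatou_set \<F>"

definition iterates :: "(complex \<Rightarrow> complex) \<Rightarrow> (complex \<Rightarrow> complex) set" where
  "iterates f = {f ^^ n | n. n \<ge> 1}"

definition affine_maps :: "(complex \<Rightarrow> complex) set" where
  "affine_maps = {\<phi>. \<exists>a b. a \<noteq> 0 \<and> \<phi> = (\<lambda>z. a * z + b)}"

text \<open>Relative compactness in the (metrizable) space of affine maps; in particular limits are
  required to be non-degenerate.\<close>

definition precompact_affine :: "(complex \<Rightarrow> complex) set \<Rightarrow> bool" where
  "precompact_affine \<Phi> \<longleftrightarrow> \<Phi> \<subseteq> affine_maps \<and>
     (\<forall>s :: nat \<Rightarrow> complex \<Rightarrow> complex. range s \<subseteq> \<Phi> \<longrightarrow>
        (\<exists>r :: nat \<Rightarrow> nat. strict_mono r \<and>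
           (\<exists>\<phi> \<in> affine_maps. loc_unif_converges (s \<circ> r) \<phi> UNIV)))"

definition nearly_abelian :: "(complex \<Rightarrow> complex) set \<Rightarrow> bool" where
  "nearly_abelian G \<longleftrightarrow>
     (\<exists>\<Phi>. precompact_affine \<Phi> \<and>
        (\<forall>\<phi>\<in>\<Phi>. \<phi> ` fatou_set G = fatou_set G) \<and>
        (\<forall>f\<in>G. \<forall>g\<in>G. \<exists>\<phi>\<in>\<Phi>. f \<circ> g = \<phi> \<circ> g \<circ> f))"

definition critical_values :: "(complex \<Rightarrow> complex) \<Rightarrow> complex set" where
  "critical_values f = f ` {z. deriv f z = 0}"

definition asymptotic_values :: "(complex \<Rightarrow> complex) \<Rightarrow> complex set" where
  "asymptotic_values f =
     {w. \<exists>\<gamma> :: real \<Rightarrow> complex. continuous_on {0..} \<gamma> \<and>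
           filterlim \<gamma> at_infinity at_top \<and> ((\<lambda>t. f (\<gamma> t)) \<longlongrightarrow> w) at_top}"

definition sing_inverse :: "(complex \<Rightarrow> complex) \<Rightarrow> complex set" where
  "sing_inverse f = closure (critical_values f \<union> asymptotic_values f)"

end

theory Submission
  imports Defs
begin

text \<open>Let \<open>I(g)\<close> be the escaping set of \<open>g\<close>, and \<open>U\<close> the interior of its complement. Singular values
  being bounded, \<open>I(g)\<close> does not meet \<open>F(g)\<close> (Eremenko and Lyubich), so \<open>F(g) \<subseteq> U\<close>. Since
  \<open>f \<circ> g\<^sup>n = \<phi>\<^sub>n \<circ> g\<^sup>n \<circ> f\<close> with \<open>\<phi>\<^sub>n\<close> in a precompact family of affine maps, \<open>f z \<in> I(g)\<close> implies
  \<open>f (g\<^sup>n z) \<longrightarrow> \<infinity>\<close> and hence \<open>z \<in> I(g)\<close>. So \<open>f\<close> and \<open>g\<close>, being open maps, send \<open>U\<close> into itself, and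
  \<open>U\<close> omits the infinite set \<open>I(g)\<close>; by Montel's theorem \<open>U \<subseteq> F(G)\<close>. Therefore \<open>F(G) = F(g)\<close>, and the
  same argument with \<open>f\<close> and \<open>g\<close> exchanged gives \<open>F(G) = F(f)\<close>.\<close>

subsection \<open>Escaping points\<close>

text \<open>The inclusions are not alike: a subfamily has the larger Fatou set, whereas F(g)
  \<subseteq> F(G) needs an open set invariant under both generators. Invariance of F(g) under
  \<open>f\<close> is not immediate, as composing with a transcendental \<open>f\<close> may destroy
  normality where iterates tend to infinity. Escape, however, is a pointwise growth condition.
  Precompactness among nondegenerate affine maps yields c > 0 and d with |phi(w)| \<ge> c|w| - d for
  the whole family, and \<open>f\<close> is bounded on bounded sets; this is enough to carry escape
  through the commutation relation. The price is that I(g) and F(g) have to be disjoint. Over the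
  complement of a large disc a map with bounded singular values is a covering, so \<open>exp\<close>
  lifts through it. If the map is transcendental, its preimage of that complement contains no circle
  about 0; hence the logarithms of this preimage contain no disc of radius above pi, and Bloch's
  theorem makes the map expand in the logarithmic metric. On a ball whose points have uniformly
  large orbits the logarithmic derivatives of the iterates at the centre would grow like 2^n, yet
  the same bound on discs keeps them below a constant.\<close>

lemma affine_if_linear_growth:
  assumes holf: "f holomorphic_on UNIV"
    and growth: "\<And>N. \<exists>r\<ge>N. \<forall>z\<in>cball 0 r. norm (f z) \<le> B * r"
  shows "\<exists>c d. \<forall>z. f z = c * z + d"
proof -
  have zero_const: "\<exists>c. \<forall>x. h x = c" if "h holomorphic_on UNIV" "\<And>x. deriv h x = 0"
    for h :: "complex \<Rightarrow> complex"
  proof -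
    have "(h has_field_derivative 0) (at x)" for x
      using holomorphic_derivI[OF that(1) open_UNIV, of x] that(2) by simp
    then show ?thesis
      using has_field_derivative_zero_constant[of UNIV h] by auto
  qed
  have d2: "deriv (deriv f) x = 0" for x
  proof (rule ccontr)
    define D where "D = norm (deriv (deriv f) x)"
    assume "deriv (deriv f) x \<noteq> 0"
    then have D: "D > 0" by (simp add: D_def)
    \<comment> \<open>\<open>2 * norm x \<le> r\<close> keeps the disc of radius \<open>r/2\<close>
      about \<open>x\<close> inside \<open>cball 0 r\<close>. Cauchy's estimate there gives
      \<open>D * r \<le> 8 * B\<close>, which the third bound,
      \<open>9 * \<bar>B\<bar> \<le> D * r\<close>, contradicts.\<close>
    obtain r where r: "r \<ge> max 1 (max (2 * norm x) (9 * \<bar>B\<bar> / D))"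
        and B: "\<And>z. z \<in> cball 0 r \<Longrightarrow> norm (f z) \<le> B * r"
      using growth by blast
    have r': "r \<ge> 1" "2 * norm x \<le> r" "9 * \<bar>B\<bar> / D \<le> r" using r by auto
    have sub: "z \<in> cball 0 r" if "z \<in> cball x (r/2)" for z
      using norm_triangle_ineq[of x "z - x"] that r' by (simp add: dist_norm norm_minus_commute)
    have "norm ((deriv ^^ 2) f x) \<le> fact 2 * (B * r) / (r/2) ^ 2"
    proof (rule Cauchy_inequality)
      show "f holomorphic_on ball x (r/2)" "continuous_on (cball x (r/2)) f"
        using holf holomorphic_on_imp_continuous_on holomorphic_on_subset by blast+
      show "0 < r/2" using r' by simp
      fix z assume "norm (x - z) = r/2"
      then show "norm (f z) \<le> B * r" by (intro B sub) (simp add: dist_norm)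
    qed
    also have "\<dots> = 8 * B / r" using r' by (simp add: power2_eq_square field_simps)
    finally have "D * r \<le> 8 * B" using r' by (simp add: D_def eval_nat_numeral field_simps)
    moreover have "9 * \<bar>B\<bar> \<le> D * r" using r' D by (simp add: field_simps)
    moreover have "D * r > 0" using D r' by simp
    ultimately show False by linarith
  qed
  have hold: "deriv f holomorphic_on UNIV" by (simp add: holf holomorphic_deriv)
  obtain c where c: "\<And>x. deriv f x = c" using zero_const[OF hold d2] by blast
  have "deriv (\<lambda>z. f z - c * z) x = 0" for x
  proof (rule DERIV_imp_deriv)
    have "(f has_field_derivative c) (at x)"
      using holomorphic_derivI[OF holf open_UNIV UNIV_I, of x] c by simp
    then show "((\<lambda>z. f z - c * z) has_field_derivative 0) (at x)"
      by (auto intro!: derivative_eq_intros)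
  qed
  then obtain d where "\<And>x. f x - c * x = d"
    using zero_const[of "\<lambda>z. f z - c * z"] holf by (auto intro!: holomorphic_intros)
  then have "f x = c * x + d" for x by (metis add.commute diff_add_cancel)
  then show ?thesis by blast
qed

lemma transcendental_not_affine:
  assumes "transcendental_entire f" shows "\<not> (\<forall>z. f z = c * z + d)"
proof
  assume "\<forall>z. f z = c * z + d"
  then have "\<forall>z. f z = poly [:d, c:] z" by (simp add: algebra_simps)
  then show False using assms unfolding transcendental_entire_def by blast
qed

text \<open>Otherwise, for arbitrarily large \<open>r\<close>, the circles of radius
  \<open>2 * r\<close> and \<open>4 * r\<close> each contain a value that \<open>f\<close> omits on
  \<open>cball 0 r\<close>. With these two values normalised to 0 and 1, Schottky's theorem bounds
  \<open>f\<close> linearly in \<open>r\<close> on the disc of half the radius, and \<open>f\<close>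
  would be affine.\<close>

lemma entire_image_contains_circle:
  assumes f: "transcendental_entire f"
  shows "\<exists>r0>0. \<forall>r\<ge>r0. \<exists>\<rho>\<ge>2 * r. sphere 0 \<rho> \<subseteq> f ` cball 0 r"
proof (rule ccontr)
  assume not: "\<not> ?thesis"
  have holf: "f holomorphic_on UNIV" using f by (simp add: transcendental_entire_def)
  \<comment> \<open>Schottky's bound for |h(0)| \<le> 2 at points of modulus at most 1/2:
    \<open>2 + 2 * 2 + 12 * (1/2) / (1 - 1/2) = 18\<close>.\<close>
  define C where "C = exp (pi * exp (pi * 18))"
  have "\<exists>r\<ge>N. \<forall>z\<in>cball 0 r. norm (f z) \<le> (4 + 12 * C) * r" for N
  proof -
    have "max 1 (max (2 * N) (norm (f 0))) > (0::real)" by simp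
    then obtain r where r: "r \<ge> max 1 (max (2 * N) (norm (f 0)))"
        and no: "\<And>\<rho>. \<rho> \<ge> 2 * r \<Longrightarrow> \<not> sphere 0 \<rho> \<subseteq> f ` cball 0 r"
      using not by meson
    have r': "r \<ge> 1" "2 * N \<le> r" "norm (f 0) \<le> r" using r by auto
    have "\<not> sphere 0 (2 * r) \<subseteq> f ` cball 0 r" using no r' by simp
    then obtain a where "a \<in> sphere 0 (2 * r)" "a \<notin> f ` cball 0 r" by blast
    then have a: "norm a = 2 * r" "a \<notin> f ` cball 0 r" by simp_all
    have "\<not> sphere 0 (4 * r) \<subseteq> f ` cball 0 r" using no r' by simp
    then obtain b where "b \<in> sphere 0 (4 * r)" "b \<notin> f ` cball 0 r" by blast
    then have b: "norm b = 4 * r" "b \<notin> f ` cball 0 r" by simp_all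
    have ba: "2 * r \<le> norm (b - a)" "norm (b - a) \<le> 6 * r"
      using norm_triangle_ineq2[of b a] norm_triangle_ineq4[of b a] a b by auto
    have ne: "b - a \<noteq> 0" using ba r' by auto
    define h where "h z = (f (of_real r * z) - a) / (b - a)" for z
    have rz: "of_real r * z \<in> cball 0 r" if "z \<in> cball 0 1" for z :: complex
      using that r' by (simp add: norm_mult mult_left_le)
    have bound: "norm (f z) \<le> (4 + 12 * C) * (r / 2)" if z: "z \<in> cball 0 (r/2)" for z
    proof -
      define u where "u = z / of_real r"
      have u: "norm u \<le> 1/2" "of_real r * u = z"
        using z r' by (auto simp: u_def norm_divide field_simps)
      have "norm (h u) \<le> exp (pi * exp (pi * (2 + 2 * 2 + 12 * (1/2) / (1 - 1/2))))"
      proof (rule Schottky[of h 2 "1/2" u])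
        have "f \<circ> (\<lambda>z. of_real r * z) holomorphic_on cball 0 1"
          by (intro holomorphic_on_compose holomorphic_intros) (use holf holomorphic_on_subset in blast)
        then show "h holomorphic_on cball 0 1"
          unfolding h_def o_def using ne by (intro holomorphic_intros) auto
        have "norm (f 0 - a) \<le> 2 * norm (b - a)"
          using norm_triangle_ineq4[of "f 0" a] a ba r' by linarith
        then show "norm (h 0) \<le> 2" using ne by (simp add: h_def norm_divide field_simps)
        show "\<not> (h x = 0 \<or> h x = 1)" if "x \<in> cball 0 1" for x
        proof -
          have "f (of_real r * x) \<noteq> a" "f (of_real r * x) \<noteq> b" using a(2) b(2) rz[OF that] by blast+
          then show ?thesis using ne by (simp add: h_def field_simps)
        qed
      qed (use u in auto)
      then have hu: "norm (h u) \<le> C" by (simp add: C_def)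
      have "f z = a + (b - a) * h u" using ne u by (simp add: h_def)
      then have "norm (f z) \<le> norm a + norm (b - a) * norm (h u)"
        by (metis norm_mult norm_triangle_ineq)
      also have "\<dots> \<le> 2 * r + 6 * r * C"
        using a ba hu r' by (intro add_mono mult_mono) (auto simp: C_def)
      finally show ?thesis by (simp add: algebra_simps)
    qed
    show ?thesis using bound r' by (intro exI[of _ "r/2"]) auto
  qed
  then have "\<exists>c d. \<forall>z. f z = c * z + d" using affine_if_linear_growth[OF holf] by meson
  then show False using transcendental_not_affine[OF f] by blast
qed

definition escaping_set :: "(complex \<Rightarrow> complex) \<Rightarrow> complex set" where
  "escaping_set f = {z. filterlim (\<lambda>n. (f ^^ n) z) at_infinity sequentially}"

lemma continuous_on_funpow:
  fixes f :: "'a::topological_space \<Rightarrow> 'a"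
  assumes "continuous_on UNIV f" shows "continuous_on UNIV (f ^^ n)"
proof (induction n)
  case 0 show ?case by (simp add: id_def)
next
  case (Suc n)
  then show ?case
    using assms continuous_on_compose[OF Suc, of f] continuous_on_subset by (auto simp: o_def)
qed

lemma transcendental_not_constant_on:
  assumes "transcendental_entire f" shows "\<not> f constant_on UNIV"
  using transcendental_not_affine[OF assms, of 0] by (auto simp: constant_on_def)

lemma open_image_entire:
  assumes "transcendental_entire f" "open U" shows "open (f ` U)"
  using open_mapping_thm[of f UNIV U] assms transcendental_not_constant_on[OF assms(1)]
  by (auto simp: transcendental_entire_def)

text \<open>The frontier of the outside lies in the compact image. By the open mapping theorem the
  image of an interior point of \<open>K\<close> has a neighbourhood disjoint from the outside, so
  only frontier points of \<open>K\<close> can be mapped there.\<close>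

lemma frontier_filled_image:
  assumes f: "transcendental_entire f" and K: "compact K"
  shows "frontier (- outside (f ` K)) \<subseteq> f ` frontier K"
proof
  have "continuous_on UNIV f"
    using f by (simp add: transcendental_entire_def holomorphic_on_imp_continuous_on)
  then have cl: "closed (f ` K)"
    by (intro compact_imp_closed compact_continuous_image K) (rule continuous_on_subset, auto)
  fix w assume w: "w \<in> frontier (- outside (f ` K))"
  then have w': "w \<in> frontier (outside (f ` K))" by simp
  then have "w \<in> f ` K" using frontier_outside_subset[OF cl] by blast
  then obtain x where x: "x \<in> K" "w = f x" by blast
  have "x \<notin> interior K"
  proof
    assume "x \<in> interior K"
    then have "w \<in> f ` interior K" using x by blast
    moreover have "open (f ` interior K)" using open_image_entire[OF f] by blast
    moreover have "f ` interior K \<inter> outside (f ` K) = {}"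
      using interior_subset outside_no_overlap by blast
    ultimately have "w \<notin> closure (outside (f ` K))"
      by (metis disjoint_iff open_Int_closure_eq_empty)
    then show False using w' by (simp add: frontier_def)
  qed
  then show "w \<in> f ` frontier K" using x K by (simp add: frontier_def compact_imp_closed)
qed

text \<open>Dominguez's argument: fill the holes of the iterated images of a large disc; the boundary of
  each filled set is covered by the image of the boundary of the previous one.\<close>

lemma escaping_set_nonempty:
  assumes f: "transcendental_entire f"
  shows "escaping_set f \<noteq> {}"
proof -
  have contf: "continuous_on UNIV f"
    using f by (simp add: transcendental_entire_def holomorphic_on_imp_continuous_on)
  obtain r0 where r0: "r0 > 0"
      and circ: "\<And>r. r \<ge> r0 \<Longrightarrow> \<exists>\<rho>\<ge>2 * r. sphere 0 \<rho> \<subseteq> f ` cball 0 r"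
    using entire_image_contains_circle[OF f] by blast
  define K where "K = rec_nat (cball 0 r0) (\<lambda>_ A. - outside (f ` A))"
  have K0: "K 0 = cball 0 r0" and KS: "K (Suc n) = - outside (f ` K n)" for n
    by (simp_all add: K_def)
  have K: "compact (K n) \<and> cball 0 (2 ^ n * r0) \<subseteq> K n" for n
  proof (induction n)
    case 0 show ?case by (simp add: K0)
  next
    case (Suc n)
    have cf: "compact (f ` K n)"
      by (intro compact_continuous_image continuous_on_subset[OF contf]) (use Suc in auto)
    have 1: "compact (K (Suc n))"
      unfolding KS using cf
      by (simp add: compact_eq_bounded_closed open_outside cobounded_outside compact_imp_closed closed_Compl)
    have "2 ^ n * r0 \<ge> r0" using r0 by simp
    then obtain \<rho> where \<rho>: "\<rho> \<ge> 2 * (2 ^ n * r0)" "sphere 0 \<rho> \<subseteq> f ` cball 0 (2 ^ n * r0)"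
      using circ by blast
    then have \<rho>0: "\<rho> > 0" using r0 by (smt (verit) mult_pos_pos zero_less_power)
    have "sphere 0 \<rho> \<subseteq> f ` K n" using \<rho>(2) Suc by blast
    then have "outside (f ` K n) \<subseteq> outside (sphere 0 \<rho>)" by (rule outside_mono)
    also have "\<dots> = - cball 0 \<rho>"
      using outside_frontier_eq_complement_closure[of "cball (0::complex) \<rho>"] \<rho>0 by simp
    finally have "cball 0 \<rho> \<subseteq> K (Suc n)" unfolding KS by blast
    moreover have "cball (0::complex) (2 ^ Suc n * r0) \<subseteq> cball 0 \<rho>" using \<rho>(1) by auto
    ultimately show ?case using 1 by blast
  qed
  have front: "frontier (K (Suc n)) \<subseteq> f ` frontier (K n)" for n
    unfolding KS using frontier_filled_image[OF f] K by blast
  have far: "2 ^ n * r0 \<le> norm z" if "z \<in> frontier (K n)" for n z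
  proof (rule ccontr)
    assume "\<not> 2 ^ n * r0 \<le> norm z"
    then have "z \<in> ball 0 (2 ^ n * r0)" by simp
    moreover have "ball 0 (2 ^ n * r0) \<subseteq> interior (K n)"
      using K[of n] by (intro interior_maximal) auto
    ultimately show False using that by (auto simp: frontier_def)
  qed
  \<comment> \<open>Points whose orbit follows the successive boundaries up to time
    \<open>n\<close>. Pulling a point of \<open>frontier (K n)\<close> back step by step shows that
    these nested compact sets are nonempty; a point common to all of them escapes, because
    \<open>frontier (K n)\<close> recedes at least like \<open>2 ^ n * r0\<close>.\<close>
  define T where "T n = (\<Inter>k\<le>n. {z. (f ^^ k) z \<in> frontier (K k)})" for n
  have reach: "\<exists>z\<in>T n. (f ^^ n) z = w" if "w \<in> frontier (K n)" for n w
    using that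
  proof (induction n arbitrary: w)
    case 0 then show ?case by (auto simp: T_def)
  next
    case (Suc n)
    then obtain v where v: "v \<in> frontier (K n)" "w = f v" using front by blast
    then obtain z where z: "z \<in> T n" "(f ^^ n) z = v" using Suc.IH by blast
    then have "z \<in> T (Suc n)" using v Suc.prems by (auto simp: T_def le_Suc_eq)
    then show ?case using z v by (auto intro: bexI[of _ z])
  qed
  have "\<Inter> (range T) \<noteq> {}"
  proof (rule compact_nest)
    fix n
    have "closed (T n)" unfolding T_def
      using continuous_on_funpow[OF contf]
      by (intro closed_INT ballI) (simp add: continuous_on_closed_vimage[of UNIV, simplified] vimage_def)
    moreover have "T n \<subseteq> frontier (K 0)" by (force simp: T_def)
    moreover have "compact (frontier (K 0))" using K compact_frontier by blast
    ultimately show "compact (T n)" by (meson closed_subset compact_eq_bounded_closed bounded_subset)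
    have "frontier (K n) \<noteq> {}"
    proof (rule frontier_not_empty)
      have "0 \<in> cball (0::complex) (2 ^ n * r0)" using r0 by simp
      then show "K n \<noteq> {}" using K[of n] by blast
      show "K n \<noteq> UNIV" using K[of n] not_bounded_UNIV compact_imp_bounded by metis
    qed
    then show "T n \<noteq> {}" using reach by blast
  next
    fix m n :: nat assume "m \<le> n"
    then show "T n \<subseteq> T m" by (auto simp: T_def)
  qed
  then obtain z where z: "\<And>n. z \<in> T n" by blast
  have "(f ^^ n) z \<in> frontier (K n)" for n using z[of n] by (auto simp: T_def)
  then have big: "2 ^ n * r0 \<le> norm ((f ^^ n) z)" for n using far by blast
  have "filterlim (\<lambda>n. 2 ^ n * r0) at_top sequentially"
    using r0 by real_asymp
  then have "filterlim (\<lambda>n. norm ((f ^^ n) z)) at_top sequentially"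
    by (rule filterlim_at_top_mono) (simp add: big)
  then have "z \<in> escaping_set f"
    by (simp add: escaping_set_def filterlim_at_infinity_conv_norm_at_top)
  then show ?thesis by blast
qed

subsection \<open>The covering property over the complement of a disc\<close>

lemma holomorphic_glue:
  fixes \<phi> :: "'i \<Rightarrow> complex \<Rightarrow> complex"
  assumes op: "\<And>i. i \<in> I \<Longrightarrow> open (U i)"
    and hol: "\<And>i. i \<in> I \<Longrightarrow> \<phi> i holomorphic_on U i"
    and compat: "\<And>i j w. \<lbrakk>i \<in> I; j \<in> I; w \<in> U i; w \<in> U j\<rbrakk> \<Longrightarrow> \<phi> i w = \<phi> j w"
  obtains \<Phi> where "\<Phi> holomorphic_on (\<Union>i\<in>I. U i)" "\<And>i w. \<lbrakk>i \<in> I; w \<in> U i\<rbrakk> \<Longrightarrow> \<Phi> w = \<phi> i w"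
proof
  define \<Phi> where "\<Phi> w = \<phi> (SOME i. i \<in> I \<and> w \<in> U i) w" for w
  show eq: "\<Phi> w = \<phi> i w" if "i \<in> I" "w \<in> U i" for i w
  proof -
    have "(SOME i. i \<in> I \<and> w \<in> U i) \<in> I \<and> w \<in> U (SOME i. i \<in> I \<and> w \<in> U i)"
      using that by (intro someI[of "\<lambda>i. i \<in> I \<and> w \<in> U i"]) auto
    then show ?thesis unfolding \<Phi>_def using compat that by blast
  qed
  have "\<Phi> holomorphic_on U i" if "i \<in> I" for i
    using hol[OF that] by (rule holomorphic_transform) (simp add: eq[OF that])
  then show "\<Phi> holomorphic_on (\<Union>i\<in>I. U i)"
    by (intro holomorphic_on_UN_open) (use op in auto)
qed

text \<open>The last clause, \<open>g (f z) = z\<close> for \<open>z\<close> near \<open>p\<close>,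
  is what later identifies \<open>g\<close> with a given branch whose values come close to
  \<open>p\<close>.\<close>

lemma local_inverse:
  assumes holf: "f holomorphic_on UNIV" and nz: "deriv f p \<noteq> 0"
  obtains \<delta> s g where "\<delta> > 0" "s > 0" "g holomorphic_on ball (f p) \<delta>" "g (f p) = p"
    "\<And>w. w \<in> ball (f p) \<delta> \<Longrightarrow> f (g w) = w"
    "\<And>z. z \<in> ball p s \<Longrightarrow> f z \<in> ball (f p) \<delta> \<and> g (f z) = z"
proof -
  obtain r where r: "r > 0" "inj_on f (ball p r)"
    using has_complex_derivative_locally_injective[OF holf UNIV_I open_UNIV nz] by blast
  have holr: "f holomorphic_on ball p r" using holf holomorphic_on_subset by blast
  obtain g where g: "g holomorphic_on f ` ball p r" "\<And>z. z \<in> ball p r \<Longrightarrow> g (f z) = z"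
    by (rule holomorphic_has_inverse[OF holr open_ball r(2)]) (rule that)
  have "open (f ` ball p r)" by (rule open_mapping_thm3[OF holr open_ball r(2)])
  moreover have "f p \<in> f ` ball p r" using r by auto
  ultimately obtain \<delta> where \<delta>: "\<delta> > 0" "ball (f p) \<delta> \<subseteq> f ` ball p r"
    using open_contains_ball by blast
  have "isCont f p"
    using holf by (meson UNIV_I continuous_on_eq_continuous_at holomorphic_on_imp_continuous_on open_UNIV)
  then obtain s where s: "s > 0" "\<And>z. dist z p < s \<Longrightarrow> dist (f z) (f p) < \<delta>"
    using \<delta>(1) unfolding continuous_at_eps_delta by blast
  show thesis
  proof
    show "\<delta> > 0" "min s r > 0" using \<delta> s r by auto
    show "g holomorphic_on ball (f p) \<delta>" using g(1) \<delta>(2) holomorphic_on_subset by blast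
    show "g (f p) = p" using g r by simp
    show "f (g w) = w" if "w \<in> ball (f p) \<delta>" for w
      using that \<delta>(2) g(2) by force
    show "f z \<in> ball (f p) \<delta> \<and> g (f z) = z" if "z \<in> ball p (min s r)" for z
      using that s(2)[of z] g(2)[of z] by (simp add: dist_commute)
  qed
qed

text \<open>\<open>f\<close> is injective near the common value at \<open>a\<close>, so both right
  inverses agree near \<open>a\<close>; the identity theorem carries this over the connected set
  \<open>S\<close>.\<close>

lemma right_inverse_unique:
  assumes holf: "f holomorphic_on UNIV"
    and S: "open S" "connected S" "a \<in> S"
    and 1: "\<phi> holomorphic_on S" "\<And>w. w \<in> S \<Longrightarrow> f (\<phi> w) = w"
    and 2: "\<psi> holomorphic_on S" "\<And>w. w \<in> S \<Longrightarrow> f (\<psi> w) = w"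
    and eq: "\<phi> a = \<psi> a" and nz: "deriv f (\<phi> a) \<noteq> 0"
    and z: "z \<in> S"
  shows "\<phi> z = \<psi> z"
proof -
  obtain r where r: "r > 0" "inj_on f (ball (\<phi> a) r)"
    using has_complex_derivative_locally_injective[OF holf UNIV_I open_UNIV nz] by blast
  define T where "T = (S \<inter> \<phi> -` ball (\<phi> a) r) \<inter> (S \<inter> \<psi> -` ball (\<phi> a) r)"
  show ?thesis
  proof (rule analytic_continuation_open[of T S \<phi> \<psi>])
    show "open T" unfolding T_def
      using 1(1) 2(1) S(1) by (intro open_Int continuous_open_preimage holomorphic_on_imp_continuous_on) auto
    have "a \<in> T" using S eq r by (simp add: T_def)
    then show "T \<noteq> {}" by blast
    fix w assume "w \<in> T"
    then show "\<phi> w = \<psi> w" using r(2) 1(2) 2(2) by (auto simp: T_def inj_on_def)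
  qed (use S 1 2 z in \<open>auto simp: T_def\<close>)
qed

text \<open>The point dividing the segment from \<open>a\<close> to \<open>b\<close> in the ratio
  \<open>s : t\<close> lies in both balls and, by convexity, in the closed disc; the open
  intersection of the balls therefore meets the open disc. This makes continuations across different
  boundary points of a disc compatible.\<close>

lemma balls_centred_on_sphere_meet_inside:
  fixes a b c :: complex
  assumes "a \<in> sphere c r" "b \<in> sphere c r" "r > 0" "x \<in> ball a s" "x \<in> ball b t"
  obtains y where "y \<in> ball a s" "y \<in> ball b t" "y \<in> ball c r"
proof -
  have st: "s > 0" "t > 0" using assms by (smt (verit) mem_ball zero_le_dist)+
  have d: "norm (b - a) < s + t"
    using assms(4,5) dist_triangle2[of a b x] by (simp add: dist_norm norm_minus_commute)
  define \<mu> where "\<mu> = s / (s + t)"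
  define y where "y = (1 - \<mu>) *\<^sub>R a + \<mu> *\<^sub>R b"
  have \<mu>: "0 < \<mu>" "\<mu> < 1" using st by (simp_all add: \<mu>_def)
  have "dist a y = \<mu> * norm (b - a)" "dist b y = (1 - \<mu>) * norm (b - a)"
  proof -
    have "y - a = \<mu> *\<^sub>R (b - a)" "b - y = (1 - \<mu>) *\<^sub>R (b - a)"
      by (simp_all add: y_def algebra_simps)
    then show "dist a y = \<mu> * norm (b - a)" "dist b y = (1 - \<mu>) * norm (b - a)"
      using \<mu> by (simp_all add: dist_norm norm_minus_commute[of a])
  qed
  moreover have "\<mu> * norm (b - a) < \<mu> * (s + t)" "(1 - \<mu>) * norm (b - a) < (1 - \<mu>) * (s + t)"
    using d \<mu> by auto
  moreover have "\<mu> * (s + t) = s" "(1 - \<mu>) * (s + t) = t"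
    using st by (simp_all add: \<mu>_def field_simps)
  ultimately have "y \<in> ball a s \<inter> ball b t" by simp
  moreover have "y \<in> closure (ball c r)"
  proof -
    have "y \<in> cball c r"
      unfolding y_def using assms(1,2) \<mu> by (intro convexD[OF convex_cball]) auto
    then show ?thesis using assms(3) by simp
  qed
  ultimately have "ball a s \<inter> ball b t \<inter> ball c r \<noteq> {}"
    by (metis disjoint_iff open_Int open_Int_closure_eq_empty open_ball)
  then show thesis using that by blast
qed

text \<open>The bound on \<open>f 0\<close> ensures that the region where \<open>norm (f z) > R\<close> omits \<open>0\<close>, so that
  inverse branches have logarithms.\<close>

locale singular_values_bounded =
  fixes f :: "complex \<Rightarrow> complex" and R :: real
  assumes transcendental: "transcendental_entire f"
    and R: "1 \<le> R" "norm (f 0) \<le> R"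
    and regular: "\<And>z. R < norm (f z) \<Longrightarrow> deriv f z \<noteq> 0"
    and no_asymptotic: "\<And>w. w \<in> asymptotic_values f \<Longrightarrow> norm w \<le> R"
begin

lemma holf: "f holomorphic_on UNIV"
  using transcendental by (simp add: transcendental_entire_def)

lemma contf: "continuous_on A f"
  using holf holomorphic_on_imp_continuous_on continuous_on_subset by blast

section \<open>Inverse branches on discs outside \<open>cball 0 R\<close>\<close>

definition inverse_branch :: "complex \<Rightarrow> real \<Rightarrow> (complex \<Rightarrow> complex) \<Rightarrow> bool" where
  "inverse_branch a r \<psi> \<longleftrightarrow> \<psi> holomorphic_on ball a r \<and> (\<forall>w\<in>ball a r. f (\<psi> w) = w)"

lemma inverse_branch_subset:
  "inverse_branch a r \<psi> \<Longrightarrow> ball b s \<subseteq> ball a r \<Longrightarrow> inverse_branch b s \<psi>"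
  unfolding inverse_branch_def using holomorphic_on_subset by blast

text \<open>Two discs have a convex, hence connected, intersection, and \<open>R < norm c\<close>
  makes the derivative of \<open>f\<close> nonzero at the common value.\<close>

lemma inverse_branch_unique:
  assumes "inverse_branch a r \<phi>" "inverse_branch b s \<psi>"
    and "c \<in> ball a r" "c \<in> ball b s" "\<phi> c = \<psi> c" "R < norm c"
    and "w \<in> ball a r" "w \<in> ball b s"
  shows "\<phi> w = \<psi> w"
proof (rule right_inverse_unique[OF holf, of "ball a r \<inter> ball b s" c \<phi> \<psi>])
  show "connected (ball a r \<inter> ball b s)" by (simp add: convex_Int convex_connected)
  show "\<phi> holomorphic_on ball a r \<inter> ball b s" "\<psi> holomorphic_on ball a r \<inter> ball b s"
    using assms(1,2) holomorphic_on_subset[OF _ Int_lower1] holomorphic_on_subset[OF _ Int_lower2]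
    unfolding inverse_branch_def by blast+
  have inv: "f (\<phi> x) = x" if "x \<in> ball a r" for x
    using assms(1) that unfolding inverse_branch_def by blast
  show "deriv f (\<phi> c) \<noteq> 0" using assms(6) inv[OF assms(3)] by (intro regular) metis
  show "f (\<phi> x) = x" if "x \<in> ball a r \<inter> ball b s" for x using inv that by blast
  show "f (\<psi> x) = x" if "x \<in> ball a r \<inter> ball b s" for x
    using assms(2) that unfolding inverse_branch_def by blast
  show "c \<in> ball a r \<inter> ball b s" "w \<in> ball a r \<inter> ball b s" "\<phi> c = \<psi> c" using assms(3-8) by blast+
qed (intro open_Int open_ball)

text \<open>A path along which \<open>f\<close> tends to a value outside \<open>cball 0 R\<close> does not tend to infinity, since
  otherwise that value would be asymptotic.\<close>

lemma inverse_branch_at_boundary: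
  assumes \<psi>: "inverse_branch a r \<psi>" and r: "r > 0" and \<zeta>: "\<zeta> \<in> sphere a r"
    and out: "R < norm \<zeta>" "ball a r \<inter> cball 0 R = {}"
  obtains \<delta> g where "\<delta> > 0" "inverse_branch \<zeta> \<delta> g"
    "\<And>w. w \<in> ball \<zeta> \<delta> \<Longrightarrow> w \<in> ball a r \<Longrightarrow> g w = \<psi> w"
proof -
  \<comment> \<open>The radius from \<open>a\<close> to \<open>\<zeta>\<close>, parametrised over
    the half-line because \<open>asymptotic_values\<close> speaks of paths on
    \<open>{0..}\<close>.\<close>
  define l where "l t = a + of_real (t / (1 + t)) * (\<zeta> - a)" for t :: real
  have l: "l t \<in> ball a r" if "t \<ge> 0" for t
  proof -
    have "t / (1 + t) < 1" "0 \<le> t / (1 + t)" using that by auto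
    then have "\<bar>t / (1 + t)\<bar> < 1" by linarith
    then have "\<bar>t / (1 + t)\<bar> * r < 1 * r" using r by (rule mult_strict_right_mono)
    moreover have "dist a (l t) = \<bar>t / (1 + t)\<bar> * norm (\<zeta> - a)"
      by (simp only: l_def dist_norm norm_minus_commute[of a] add_diff_cancel_left' norm_mult norm_of_real)
    ultimately show ?thesis using \<zeta> by (simp add: dist_norm norm_minus_commute)
  qed
  have contl: "continuous_on {0..} l"
    unfolding l_def by (intro continuous_intros) auto
  have liml: "(l \<longlongrightarrow> \<zeta>) at_top"
  proof -
    have "((\<lambda>t::real. t / (1 + t)) \<longlongrightarrow> 1) at_top" by real_asymp
    then have "(l \<longlongrightarrow> a + of_real 1 * (\<zeta> - a)) at_top"
      unfolding l_def by (intro tendsto_intros)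
    then show ?thesis by simp
  qed
  define \<gamma> where "\<gamma> t = \<psi> (l t)" for t
  have f\<gamma>: "f (\<gamma> t) = l t" if "t \<ge> 0" for t
    using \<psi> l[OF that] by (simp add: inverse_branch_def \<gamma>_def)
  have cont\<gamma>: "continuous_on {0..} \<gamma>"
  proof -
    have "continuous_on (l ` {0..}) \<psi>"
      using \<psi> l unfolding inverse_branch_def
      by (meson atLeast_iff continuous_on_subset holomorphic_on_imp_continuous_on image_subsetI)
    then show ?thesis using continuous_on_compose[OF contl] unfolding \<gamma>_def o_def by blast
  qed
  have lim\<gamma>: "((\<lambda>t. f (\<gamma> t)) \<longlongrightarrow> \<zeta>) at_top"
    using liml by (rule Lim_transform_eventually)
      (auto intro!: eventually_mono[OF eventually_ge_at_top[of 0]] simp: f\<gamma>)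
  have "\<not> filterlim \<gamma> at_infinity at_top"
  proof
    assume "filterlim \<gamma> at_infinity at_top"
    then have "\<zeta> \<in> asymptotic_values f" using cont\<gamma> lim\<gamma> unfolding asymptotic_values_def by blast
    then show False using no_asymptotic out by force
  qed
  then obtain M where M: "\<not> (\<forall>\<^sub>F t in at_top. M \<le> norm (\<gamma> t))"
    unfolding filterlim_at_infinity[OF order_refl] by blast
  have "\<exists>t\<ge>real k. norm (\<gamma> t) < M" for k
    using M unfolding eventually_at_top_linorder by (meson not_le)
  then obtain t where t: "\<And>k. t k \<ge> real k" "\<And>k. norm (\<gamma> (t k)) < M" by metis
  have "\<forall>k. \<gamma> (t k) \<in> cball 0 M" using t(2) by (simp add: less_imp_le)
  then obtain p q where q: "strict_mono (q :: nat \<Rightarrow> nat)" and p: "(\<lambda>k. \<gamma> (t (q k))) \<longlonglongrightarrow> p"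
    using compact_cball[of "0::complex" M] unfolding compact_def o_def
    by (elim allE[of _ "\<lambda>k. \<gamma> (t k)"]) blast
  have t_top: "filterlim (\<lambda>k. t (q k)) at_top sequentially"
  proof (rule filterlim_at_top_mono[OF filterlim_real_sequentially])
    show "\<forall>\<^sub>F k in sequentially. real k \<le> t (q k)"
      using t(1) q by (intro always_eventually allI)
        (meson of_nat_le_iff order_trans strict_mono_imp_increasing)
  qed
  have "(\<lambda>k. f (\<gamma> (t (q k)))) \<longlonglongrightarrow> \<zeta>" by (rule filterlim_compose[OF lim\<gamma> t_top])
  moreover have "(\<lambda>k. f (\<gamma> (t (q k)))) \<longlonglongrightarrow> f p"
    using contf[of UNIV] p by (intro continuous_on_tendsto_compose[of UNIV f]) auto
  ultimately have fp: "f p = \<zeta>" using LIMSEQ_unique by blast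
  then have "deriv f p \<noteq> 0" using regular out by simp
  then obtain \<delta> s g where g: "\<delta> > 0" "s > 0" "g holomorphic_on ball \<zeta> \<delta>"
      "\<And>w. w \<in> ball \<zeta> \<delta> \<Longrightarrow> f (g w) = w"
      "\<And>z. z \<in> ball p s \<Longrightarrow> f z \<in> ball \<zeta> \<delta> \<and> g (f z) = z"
    using local_inverse[OF holf, of p] unfolding fp by metis
  have "\<forall>\<^sub>F k in sequentially. dist (\<gamma> (t (q k))) p < s" using p g(2) by (rule tendstoD)
  then obtain k where "dist (\<gamma> (t (q k))) p < s" by (meson eventually_happens' sequentially_bot)
  then have k: "\<gamma> (t (q k)) \<in> ball p s" by (simp add: dist_commute)
  \<comment> \<open>The lifted path comes close to \<open>p\<close>, so at one of its points the
    local inverse \<open>g\<close> takes the same value as \<open>\<psi>\<close>; uniqueness then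
    gives agreement on the whole overlap of the two discs.\<close>
  define c where "c = l (t (q k))"
  have tk: "t (q k) \<ge> 0" using t(1)[of "q k"] by linarith
  have c: "c \<in> ball a r" "c \<in> ball \<zeta> \<delta>" "g c = \<psi> c"
    using l[OF tk] g(5)[OF k] f\<gamma>[OF tk] by (simp_all add: c_def \<gamma>_def)
  have ib: "inverse_branch \<zeta> \<delta> g" using g by (simp add: inverse_branch_def)
  have "R < norm c" using c(1) out(2) by force
  then show thesis
    using that[OF g(1) ib] inverse_branch_unique[OF ib \<psi> c(2) c(1) c(3)] by blast
qed

text \<open>The branch continues across every boundary point. Two such continuations agree where
  they overlap, since their discs then also meet inside \<open>ball a r\<close>, where both equal
  \<open>\<psi>\<close>. Compactness of the closed disc turns the local continuations into a uniform
  gain in radius.\<close>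

lemma inverse_branch_extend:
  assumes \<psi>: "inverse_branch a r \<psi>" and r: "0 < r" "r < \<rho>"
    and out: "ball a \<rho> \<inter> cball 0 R = {}"
  obtains r' \<psi>' where "r < r'" "inverse_branch a r' \<psi>'" "\<psi>' a = \<psi> a"
proof -
  define I where "I = insert (a, r, \<psi>) {(\<zeta>, \<delta>, g). \<zeta> \<in> sphere a r \<and> \<delta> > 0 \<and> inverse_branch \<zeta> \<delta> g \<and>
      (\<forall>w\<in>ball \<zeta> \<delta> \<inter> ball a r. g w = \<psi> w)}"
  define U where "U = (\<lambda>(\<zeta>, \<delta>, g :: complex \<Rightarrow> complex). ball (\<zeta> :: complex) \<delta>)"
  define \<phi> where "\<phi> = (\<lambda>(\<zeta> :: complex, \<delta> :: real, g :: complex \<Rightarrow> complex). g)"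
  have outr: "ball a r \<inter> cball 0 R = {}" using out r subset_ball[of r \<rho> a] by auto
  have I1: "inverse_branch \<zeta> \<delta> g \<and> (\<forall>w\<in>ball \<zeta> \<delta> \<inter> ball a r. g w = \<psi> w)"
    if "(\<zeta>, \<delta>, g) \<in> I" for \<zeta> \<delta> g
    using that \<psi> by (auto simp: I_def)
  have compat: "g w = h w" if 1: "(\<zeta>, \<delta>, g) \<in> I" and 2: "(\<xi>, \<epsilon>, h) \<in> I"
    and w: "w \<in> ball \<zeta> \<delta>" "w \<in> ball \<xi> \<epsilon>" for \<zeta> \<delta> g \<xi> \<epsilon> h w
  proof (cases "(\<zeta>, \<delta>, g) = (a, r, \<psi>) \<or> (\<xi>, \<epsilon>, h) = (a, r, \<psi>)")
    case True
    then show ?thesis using I1[OF 1] I1[OF 2] w by auto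
  next
    case False
    then have "\<zeta> \<in> sphere a r" "\<xi> \<in> sphere a r" using 1 2 by (auto simp: I_def)
    then obtain y where y: "y \<in> ball \<zeta> \<delta>" "y \<in> ball \<xi> \<epsilon>" "y \<in> ball a r"
      using balls_centred_on_sphere_meet_inside w r by metis
    have "g y = h y" using I1[OF 1] I1[OF 2] y by simp
    moreover have "R < norm y" using y(3) outr by force
    ultimately show ?thesis using inverse_branch_unique[of \<zeta> \<delta> g \<xi> \<epsilon> h y w] I1[OF 1] I1[OF 2] y w by blast
  qed
  obtain \<Phi> where \<Phi>: "\<Phi> holomorphic_on (\<Union>i\<in>I. U i)" "\<And>i w. \<lbrakk>i \<in> I; w \<in> U i\<rbrakk> \<Longrightarrow> \<Phi> w = \<phi> i w"
  proof (rule holomorphic_glue[of I U \<phi>])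
    fix i assume i: "i \<in> I"
    show "open (U i)" by (auto simp: U_def split: prod.splits)
    show "\<phi> i holomorphic_on U i"
      using I1 i by (auto simp: U_def \<phi>_def inverse_branch_def split: prod.splits)
  next
    fix i j w assume "i \<in> I" "j \<in> I" "w \<in> U i" "w \<in> U j"
    then show "\<phi> i w = \<phi> j w"
      using compat by (auto simp: U_def \<phi>_def split: prod.splits)
  qed blast
  have \<Phi>I: "\<Phi> w = g w" if "(\<zeta>, \<delta>, g) \<in> I" "w \<in> ball \<zeta> \<delta>" for \<zeta> \<delta> g w
    using \<Phi>(2)[OF that(1)] that(2) by (simp add: U_def \<phi>_def)
  have f\<Phi>: "f (\<Phi> w) = w" if w: "w \<in> (\<Union>i\<in>I. U i)" for w
  proof -
    obtain i where i: "i \<in> I" "w \<in> U i" using w by blast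
    obtain \<zeta> \<delta> g where "i = (\<zeta>, \<delta>, g)" by (rule prod_cases3)
    with i have i: "(\<zeta>, \<delta>, g) \<in> I" "w \<in> ball \<zeta> \<delta>" by (simp_all add: U_def)
    then show ?thesis using I1[OF i(1)] \<Phi>I[OF i] by (simp add: inverse_branch_def)
  qed
  have "cball a r \<subseteq> (\<Union>i\<in>I. U i)"
  proof
    fix \<zeta> assume \<zeta>: "\<zeta> \<in> cball a r"
    show "\<zeta> \<in> (\<Union>i\<in>I. U i)"
    proof (cases "\<zeta> \<in> ball a r")
      case True
      then show ?thesis by (force simp: I_def U_def)
    next
      case False
      then have s: "\<zeta> \<in> sphere a r" using \<zeta> by auto
      then have "\<zeta> \<in> ball a \<rho>" using r by simp
      then have "R < norm \<zeta>" using out by force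
      then obtain \<delta> g where "\<delta> > 0" "inverse_branch \<zeta> \<delta> g"
        "\<And>w. w \<in> ball \<zeta> \<delta> \<Longrightarrow> w \<in> ball a r \<Longrightarrow> g w = \<psi> w"
        using inverse_branch_at_boundary[OF \<psi> r(1) s _ outr] by metis
      then have "(\<zeta>, \<delta>, g) \<in> I" "\<zeta> \<in> U (\<zeta>, \<delta>, g)" using s by (auto simp: I_def U_def)
      then show ?thesis by blast
    qed
  qed
  moreover have "open (\<Union>i\<in>I. U i)" by (auto simp: U_def split: prod.splits)
  ultimately obtain \<epsilon> where \<epsilon>: "\<epsilon> > 0" "(\<Union>x\<in>cball a r. ball x \<epsilon>) \<subseteq> (\<Union>i\<in>I. U i)"
    using compact_subset_open_imp_ball_epsilon_subset[OF compact_cball] by metis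
  have "ball a (r + \<epsilon>) \<subseteq> (\<Union>x\<in>cball a r. ball x \<epsilon>)"
  proof
    fix w assume w: "w \<in> ball a (r + \<epsilon>)"
    show "w \<in> (\<Union>x\<in>cball a r. ball x \<epsilon>)"
    proof (cases "w \<in> cball a r")
      case True
      then show ?thesis using \<epsilon> by force
    next
      case False
      define d where "d = norm (w - a)"
      have d: "r < d" "d < r + \<epsilon>" using w False by (simp_all add: d_def dist_norm norm_minus_commute)
      define x where "x = a + (r / d) *\<^sub>R (w - a)"
      have "x \<in> cball a r" using d r by (simp add: x_def dist_norm d_def[symmetric])
      moreover have "w - x = (1 - r / d) *\<^sub>R (w - a)" by (simp add: x_def algebra_simps)
      then have "norm (w - x) = \<bar>1 - r / d\<bar> * d" by (simp add: d_def)
      then have "norm (w - x) = d - r" 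
      proof -
        have "r / d < 1" using d r by simp
        then have "\<bar>1 - r / d\<bar> * d = (1 - r / d) * d" by simp
        also have "\<dots> = d - r" using d r by (simp add: field_simps)
        finally show ?thesis using \<open>norm (w - x) = \<bar>1 - r / d\<bar> * d\<close> by simp
      qed
      then have "w \<in> ball x \<epsilon>" using d by (simp add: dist_norm norm_minus_commute)
      ultimately show ?thesis by blast
    qed
  qed
  then have sub: "ball a (r + \<epsilon>) \<subseteq> (\<Union>i\<in>I. U i)" using \<epsilon>(2) by blast
  have "inverse_branch a (r + \<epsilon>) \<Phi>"
    unfolding inverse_branch_def using \<Phi>(1) f\<Phi> sub holomorphic_on_subset by blast
  moreover have "\<Phi> a = \<psi> a" using \<Phi>I[of a r \<psi> a] r by (simp add: I_def)
  ultimately show thesis using that[of "r + \<epsilon>" \<Phi>] \<epsilon> by simp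
qed

text \<open>Continuity argument on the radius. The branches on smaller discs all take the value
  \<open>z\<close> at \<open>f z\<close>, so they agree and can be glued: the supremum of the
  admissible radii is attained. By the extension lemma it cannot lie below
  \<open>\<rho>\<close>.\<close>

lemma inverse_branch_exists:
  assumes \<rho>: "\<rho> > 0" and out: "ball (f z) \<rho> \<inter> cball 0 R = {}"
  obtains \<psi> where "inverse_branch (f z) \<rho> \<psi>" "\<psi> (f z) = z"
proof -
  define P where "P r \<longleftrightarrow> (\<exists>\<psi>. inverse_branch (f z) r \<psi> \<and> \<psi> (f z) = z)" for r
  define A where "A = {r. 0 < r \<and> r \<le> \<rho> \<and> P r}"
  have far: "R < norm w" if "w \<in> ball (f z) \<rho>" for w using out that by force
  have Rz: "R < norm (f z)" using far \<rho> by simp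
  have P_mono: "P r" if "P r'" "r \<le> r'" for r r'
    using that inverse_branch_subset subset_ball unfolding P_def by blast
  obtain \<delta> s g where "\<delta> > 0" "g holomorphic_on ball (f z) \<delta>" "g (f z) = z"
      "\<And>w. w \<in> ball (f z) \<delta> \<Longrightarrow> f (g w) = w"
    using local_inverse[OF holf regular[OF Rz]] by metis
  then have "P \<delta>" unfolding P_def inverse_branch_def by blast
  then have A1: "min \<delta> \<rho> \<in> A" using \<open>\<delta> > 0\<close> \<rho> P_mono by (auto simp: A_def)
  have bdd: "bdd_above A" by (auto simp: A_def)
  define S where "S = Sup A"
  have S: "0 < S" "S \<le> \<rho>"
  proof -
    have "min \<delta> \<rho> \<le> S" unfolding S_def using A1 bdd by (rule cSup_upper)
    then show "0 < S" using \<open>\<delta> > 0\<close> \<rho> by linarith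
    show "S \<le> \<rho>" unfolding S_def
    proof (rule cSup_least)
      show "A \<noteq> {}" using A1 by blast
    qed (simp add: A_def)
  qed
  have P_less: "P r" if "r < S" for r
  proof -
    have "A \<noteq> {}" "r < Sup A" using A1 that S_def by blast+
    then have "\<exists>r'\<in>A. r < r'" by (rule less_cSupD)
    then obtain r' where "r' \<in> A" "r < r'" by blast
    then show ?thesis using P_mono[of r' r] by (simp add: A_def)
  qed
  have "P S"
  proof -
    define I where "I = {(r, \<psi>). 0 < r \<and> r < S \<and> inverse_branch (f z) r \<psi> \<and> \<psi> (f z) = z}"
    obtain \<Phi> where \<Phi>: "\<Phi> holomorphic_on (\<Union>i\<in>I. ball (f z) (fst i))"
        "\<And>i w. \<lbrakk>i \<in> I; w \<in> ball (f z) (fst i)\<rbrakk> \<Longrightarrow> \<Phi> w = snd i w"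
    proof (rule holomorphic_glue[of I "\<lambda>i. ball (f z) (fst i)" snd])
      fix i j w assume "i \<in> I" "j \<in> I" "w \<in> ball (f z) (fst i)" "w \<in> ball (f z) (fst j)"
      then show "snd i w = snd j w"
        using inverse_branch_unique[of "f z" "fst i" "snd i" "f z" "fst j" "snd j" "f z" w] Rz
        by (auto simp: I_def)
    qed (auto simp: I_def inverse_branch_def)
    have cover: "\<exists>i\<in>I. w \<in> ball (f z) (fst i)" if "w \<in> ball (f z) S" for w
    proof -
      have "0 \<le> dist (f z) w" "dist (f z) w < S" using that by auto
      then obtain r where r: "dist (f z) w < r" "r < S" using dense by blast
      then obtain \<psi> where "inverse_branch (f z) r \<psi>" "\<psi> (f z) = z" using P_less P_def by blast
      moreover have "0 < r" using r(1) by (meson le_less_trans zero_le_dist)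
      ultimately show ?thesis using r by (intro bexI[of _ "(r, \<psi>)"]) (auto simp: I_def)
    qed
    have "\<Phi> holomorphic_on ball (f z) S"
      using \<Phi>(1) cover by (elim holomorphic_on_subset) blast
    moreover have "f (\<Phi> w) = w" if "w \<in> ball (f z) S" for w
      using cover[OF that] \<Phi>(2) by (auto simp: I_def inverse_branch_def)
    moreover have "\<Phi> (f z) = z"
      using cover[of "f z"] S \<Phi>(2) by (auto simp: I_def)
    ultimately show ?thesis unfolding P_def inverse_branch_def by blast
  qed
  have "S = \<rho>"
  proof (rule ccontr)
    assume "S \<noteq> \<rho>"
    then have S': "S < \<rho>" using S by simp
    obtain \<psi> where \<psi>: "inverse_branch (f z) S \<psi>" "\<psi> (f z) = z" using \<open>P S\<close> P_def by blast
    obtain r' \<psi>' where "S < r'" "inverse_branch (f z) r' \<psi>'" "\<psi>' (f z) = \<psi> (f z)"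
      using inverse_branch_extend[OF \<psi>(1) S(1) S' out] by metis
    then have "P r'" "S < r'" using \<psi>(2) by (auto simp: P_def)
    then have "min r' \<rho> \<in> A" using P_mono S \<rho> by (auto simp: A_def)
    then have "min r' \<rho> \<le> S" unfolding S_def using bdd by (rule cSup_upper)
    then show False using S' \<open>S < r'\<close> by simp
  qed
  then show thesis using \<open>P S\<close> that unfolding P_def by blast
qed

section \<open>The preimage of the complement of the disc and its covering map\<close>

abbreviation E where "E \<equiv> {z. R < norm (f z)}"

lemma open_E: "open E"
  by (intro open_Collect_less continuous_intros contf)

text \<open>A branch at a value w fills the disc of radius |w| - R about w. This makes the image
  both open and relatively closed in a connected set, and Liouville's theorem excludes the empty
  image.\<close>

lemma image_E: "f ` E = - cball 0 R"
proof -
  let ?S = "- cball (0::complex) R"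
  have sub: "f ` E \<subseteq> ?S" by auto
  have cS: "connected ?S" by (intro connected_complement_bounded_convex) auto
  have "E \<noteq> {}"
  proof
    assume "E = {}"
    then have "\<And>z. norm (f z) \<le> R" by (auto simp: not_less)
    then have "bounded (range f)" by (auto intro: boundedI)
    then obtain c where "\<And>z. f z = c" using Liouville_theorem[OF holf] by (metis constant_on_def UNIV_I)
    then have "\<forall>z. f z = poly [:c:] z" by simp
    then show False using transcendental unfolding transcendental_entire_def by blast
  qed
  have near: "w' \<in> f ` E" if w: "w \<in> f ` E" and d: "dist w w' < norm w - R" for w w'
  proof -
    obtain z where z: "w = f z" "R < norm (f z)" using w by blast
    have "ball (f z) (norm w - R) \<inter> cball 0 R = {}"
    proof -
      have "R < norm x" if "x \<in> ball (f z) (norm w - R)" for x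
        using that norm_triangle_ineq2[of w x] z by (simp add: dist_norm)
      then show ?thesis by force
    qed
    then obtain \<psi> where "inverse_branch (f z) (norm w - R) \<psi>"
      using inverse_branch_exists[of "norm w - R" z] z by auto
    then have "f (\<psi> w') = w'" using d z by (simp add: inverse_branch_def)
    moreover have "R < norm w'" using norm_triangle_ineq2[of w w'] d by (simp add: dist_norm)
    ultimately show ?thesis by (metis (mono_tags) image_eqI mem_Collect_eq)
  qed
  have "open (f ` E)" unfolding open_dist
  proof
    fix w assume w: "w \<in> f ` E"
    then have "norm w - R > 0" by auto
    then show "\<exists>e>0. \<forall>y. dist y w < e \<longrightarrow> y \<in> f ` E"
      using near[OF w] by (intro exI[of _ "norm w - R"]) (auto simp: dist_commute)
  qed
  moreover have "open (?S - f ` E)" unfolding open_dist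
  proof
    fix w assume w: "w \<in> ?S - f ` E"
    then have pos: "norm w - R > 0" by auto
    \<comment> \<open>The factor 1/2 makes the relation symmetric: \<open>w\<close> is then closer
      to \<open>y\<close> than \<open>norm y - R\<close>, so if \<open>y\<close> were a value,
      \<open>w\<close> would be one too.\<close>
    have "y \<in> ?S - f ` E" if y: "dist y w < (norm w - R) / 2" for y
    proof -
      have "(norm w - R) / 2 < norm y - R"
        using norm_triangle_ineq2[of w y] y by (simp add: dist_norm norm_minus_commute field_simps)
      then show ?thesis using near[of y w] w y pos by auto
    qed
    then show "\<exists>e>0. \<forall>y. dist y w < e \<longrightarrow> y \<in> ?S - f ` E"
      using pos by (intro exI[of _ "(norm w - R) / 2"]) auto
  qed
  ultimately have "f ` E \<inter> ?S = {} \<or> (?S - f ` E) \<inter> ?S = {}"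
    using cS by (intro connectedD) auto
  then show ?thesis using sub \<open>E \<noteq> {}\<close> by blast
qed

lemma covering: "covering_space E f (- cball 0 R)"
proof
  show "continuous_on E f" by (rule contf)
  show "f ` E = - cball 0 R" by (rule image_E)
  fix x :: complex assume x: "x \<in> - cball 0 R"
  \<comment> \<open>Half the distance to the disc: a ball of radius \<open>d\<close> about any point
    of \<open>ball x d\<close> still avoids \<open>cball 0 R\<close>. Hence a branch through a given
    preimage of \<open>y\<close> can be built around \<open>y\<close>, evaluated at
    \<open>x\<close>, and rebuilt around \<open>x\<close>.\<close>
  define d where "d = (norm x - R) / 2"
  have d: "d > 0" using x by (simp add: d_def)
  have far: "R < norm w" if "w \<in> ball y d" "y \<in> ball x d" for w y
    using that norm_triangle_ineq2[of x y] norm_triangle_ineq2[of y w] by (simp add: d_def dist_norm)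
  define V where "V = {\<psi> ` ball x d | \<psi>. inverse_branch x d \<psi>}"
  have far': "R < norm w" if "w \<in> ball x d" for w using far[of w w] that d by simp
  have "\<Union>V = E \<inter> f -` ball x d"
  proof
    show "\<Union>V \<subseteq> E \<inter> f -` ball x d" using far' by (auto simp: V_def inverse_branch_def)
    show "E \<inter> f -` ball x d \<subseteq> \<Union>V"
    proof
      fix z assume "z \<in> E \<inter> f -` ball x d"
      then have z: "f z \<in> ball x d" by simp
      have "ball (f z) d \<inter> cball 0 R = {}" using far[OF _ z] by force
      then obtain \<phi> where \<phi>: "inverse_branch (f z) d \<phi>" "\<phi> (f z) = z"
        using inverse_branch_exists d by blast
      have xz: "x \<in> ball (f z) d" using z by (simp add: dist_commute)
      then have fx: "f (\<phi> x) = x" using \<phi>(1) by (simp add: inverse_branch_def)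
      have "ball (f (\<phi> x)) d \<inter> cball 0 R = {}" using far' fx by force
      then obtain \<psi> where \<psi>: "inverse_branch x d \<psi>" "\<psi> x = \<phi> x"
        using inverse_branch_exists[OF d, of "\<phi> x"] fx by metis
      have "\<phi> (f z) = \<psi> (f z)"
        using inverse_branch_unique[OF \<phi>(1) \<psi>(1) xz] \<psi>(2) far' d z by simp
      then have "z \<in> \<psi> ` ball x d" using \<phi>(2) z by (metis image_eqI)
      then show "z \<in> \<Union>V" using \<psi>(1) by (auto simp: V_def)
    qed
  qed
  moreover have "openin (top_of_set E) u \<and> (\<exists>q. homeomorphism u (ball x d) f q)" if u: "u \<in> V" for u
  proof -
    obtain \<psi> where \<psi>: "inverse_branch x d \<psi>" "u = \<psi> ` ball x d" using u by (auto simp: V_def)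
    have hol: "\<psi> holomorphic_on ball x d" and inv: "\<And>w. w \<in> ball x d \<Longrightarrow> f (\<psi> w) = w"
      using \<psi> by (auto simp: inverse_branch_def)
    have "inj_on \<psi> (ball x d)" by (rule inj_on_inverseI[of _ f]) (use inv in auto)
    then have "open u" unfolding \<psi>(2) using hol by (intro open_mapping_thm3) auto
    moreover have "u \<subseteq> E" using inv far' \<psi>(2) by auto
    moreover have "homeomorphism u (ball x d) f \<psi>"
    proof (rule homeomorphismI)
      show "continuous_on u f" by (rule contf)
      show "continuous_on (ball x d) \<psi>" using hol by (rule holomorphic_on_imp_continuous_on)
    qed (use \<psi>(2) inv in auto)
    ultimately show ?thesis using open_E by (auto simp: openin_open_eq)
  qed
  moreover have "pairwise disjnt V"
  proof (rule pairwiseI)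
    fix u v assume uv: "u \<in> V" "v \<in> V" "u \<noteq> v"
    then obtain \<phi> \<psi> where 1: "inverse_branch x d \<phi>" "u = \<phi> ` ball x d"
      and 2: "inverse_branch x d \<psi>" "v = \<psi> ` ball x d" by (auto simp: V_def)
    show "disjnt u v"
    proof (rule ccontr)
      assume "\<not> disjnt u v"
      then obtain w w' where w: "w \<in> ball x d" "w' \<in> ball x d" "\<phi> w = \<psi> w'"
        using 1 2 by (auto simp: disjnt_def)
      then have "w = w'" using 1(1) 2(1) by (metis inverse_branch_def)
      then have "\<phi> y = \<psi> y" if "y \<in> ball x d" for y
        using inverse_branch_unique[OF 1(1) 2(1) w(1) w(1) _ far'[OF w(1)]] w that by blast
      then have "u = v" using 1(2) 2(2) by auto
      then show False using uv by blast
    qed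
  qed
  moreover have "x \<in> ball x d" using d by simp
  moreover have "openin (top_of_set (- cball 0 R)) (ball x d)"
    using far' by (intro open_subset) force+
  ultimately show "\<exists>T. x \<in> T \<and> openin (top_of_set (- cball 0 R)) T \<and>
       (\<exists>v. \<Union>v = E \<inter> f -` T \<and> (\<forall>u\<in>v. openin (top_of_set E) u) \<and>
          pairwise disjnt v \<and> (\<forall>u\<in>v. \<exists>q. homeomorphism u T f q))"
    by (intro exI[of _ "ball x d"] exI[of _ V] conjI ballI) simp_all
qed

subsection \<open>Logarithmic coordinates\<close>

lemma R_pos: "0 < R" using R(1) by simp

abbreviation H where "H \<equiv> {\<zeta>. ln R < Re \<zeta>}"

lemma exp_in_H: "R < norm (exp \<zeta>) \<longleftrightarrow> \<zeta> \<in> H"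
  using R(1) ln_less_cancel_iff[of R "exp (Re \<zeta>)"] by simp

lemma exp_H: "exp \<in> H \<rightarrow> - cball 0 R"
  using exp_in_H by force

text \<open>The half-plane \<open>H\<close> is simply connected and \<open>exp\<close> maps it into
  the base of the covering, so the lifting criterion applies; a continuous lift through a
  holomorphic covering is holomorphic.\<close>

lemma exp_lift:
  assumes "exp \<zeta> = f z" "R < norm (f z)"
  obtains \<psi> where "\<psi> holomorphic_on H" "\<psi> \<zeta> = z" "\<And>\<xi>. \<xi> \<in> H \<Longrightarrow> f (\<psi> \<xi>) = exp \<xi>"
proof -
  have z: "z \<in> E" "\<zeta> \<in> H" using assms exp_in_H[of \<zeta>] by auto
  have cH: "convex H" by (simp add: convex_halfspace_Re_gt)
  obtain \<psi> where \<psi>: "continuous_on H \<psi>" "\<psi> \<in> H \<rightarrow> E" "\<psi> \<zeta> = z" "\<And>y. y \<in> H \<Longrightarrow> f (\<psi> y) = exp y"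
  proof (rule covering_space_lift_strong[OF covering z(1) z(2)])
    show "simply_connected H" "locally path_connected H"
      using cH convex_imp_simply_connected convex_imp_locally_path_connected by blast+
    show "continuous_on H exp" by (intro continuous_intros)
    show "exp \<in> H \<rightarrow> - cball 0 R" by (rule exp_H)
    show "exp \<zeta> = f z" by (rule assms)
  qed blast
  have "\<psi> holomorphic_on H"
  proof (rule covering_space_lift_is_holomorphic[OF covering open_E])
    show "f holomorphic_on E" using holf holomorphic_on_subset by blast
    show "exp holomorphic_on H" by (intro holomorphic_intros)
    show "exp \<in> H \<rightarrow> - cball 0 R" by (rule exp_H)
  qed (use \<psi> in auto)
  then show thesis using \<psi> that by blast
qed

text \<open>A periodic lift would factor through \<open>w \<mapsto> - k Ln w\<close>, whence a simple removable singularity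
  of the factor at \<open>0\<close> forces \<open>f\<close> to have a pole at infinity.\<close>

lemma exp_lift_not_periodic:
  assumes hol: "\<psi> holomorphic_on H" and f\<psi>: "\<And>\<xi>. \<xi> \<in> H \<Longrightarrow> f (\<psi> \<xi>) = exp \<xi>"
    and k: "k \<ge> (1::nat)"
    and per: "\<And>\<xi>. \<xi> \<in> H \<Longrightarrow> \<psi> (\<xi> + 2 * pi * \<i> * of_nat k) = \<psi> \<xi>"
  shows False
proof -
  have per_nat: "\<psi> (\<xi> + 2 * pi * \<i> * of_nat k * of_nat n) = \<psi> \<xi>" if "\<xi> \<in> H" for \<xi> and n :: nat
  proof (induction n)
    case (Suc n)
    have "\<xi> + 2 * pi * \<i> * of_nat k * of_nat n \<in> H" using that by simp
    from per[OF this] show ?case using Suc by (simp add: algebra_simps)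
  qed simp
  have per_int: "\<psi> (\<xi> + 2 * pi * \<i> * of_nat k * of_int m) = \<psi> \<xi>" if "\<xi> \<in> H" for \<xi> and m :: int
  proof (cases "m \<ge> 0")
    case True
    then show ?thesis using per_nat[OF that, of "nat m"] by simp
  next
    case False
    define \<eta> where "\<eta> = \<xi> + 2 * pi * \<i> * of_nat k * of_int m"
    have "\<eta> \<in> H" using that by (simp add: \<eta>_def)
    from per_nat[OF this, of "nat (- m)"] show ?thesis using False by (simp add: \<eta>_def)
  qed
  \<comment> \<open>For \<open>norm w < \<delta>\<close> the real part of \<open>- Ln w\<close>
    exceeds \<open>ln (1 + R)\<close>. Since \<delta> < 1 it is positive, so multiplying by
    \<open>k\<close> does not lower it and the argument of \<psi> stays in \<open>H\<close>.\<close>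
  define \<delta> where "\<delta> = inverse (1 + R)"
  have \<delta>: "0 < \<delta>" "\<delta> < 1" using R(1) by (simp_all add: \<delta>_def field_simps)
  have inH: "- of_nat k * \<xi> \<in> H" if "Re \<xi> < ln \<delta>" for \<xi>
  proof -
    have "ln R < ln (1 + R)" using R(1) by simp
    also have "\<dots> = - ln \<delta>" using R(1) by (simp add: \<delta>_def ln_inverse)
    also have "\<dots> < - Re \<xi>" using that by simp
    also have "\<dots> \<le> real k * (- Re \<xi>)"
    proof -
      have "0 \<le> - Re \<xi>" using that \<delta> by (smt (verit) ln_less_zero)
      moreover have "1 \<le> real k" using k by simp
      ultimately show ?thesis by (metis mult_le_cancel_right1 not_less)
    qed
    finally show ?thesis by simp
  qed
  \<comment> \<open>The period of \<psi> is exactly the ambiguity of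
    \<open>- of_nat k * Ln w\<close>, so \<open>q\<close> does not jump at the branch cut, and
    \<open>f (inverse (q w)) = inverse w ^ k\<close>.\<close>
  define q where "q w = inverse (\<psi> (- of_nat k * Ln w))" for w
  have q_branch: "q w = inverse (\<psi> (- of_nat k * \<xi>))" if "exp \<xi> = w" "norm w < \<delta>" for \<xi> w
  proof -
    have w0: "w \<noteq> 0" using that by auto
    have Re: "Re \<xi> < ln \<delta>" using that \<delta> by (metis exp_less_cancel_iff exp_ln norm_exp_eq_Re)
    have "exp (Ln w) = exp \<xi>" using w0 that by simp
    then obtain m :: int where m: "Ln w = \<xi> + of_real (2 * of_int m * pi) * \<i>"
      unfolding exp_eq by auto
    have "- of_nat k * Ln w = - of_nat k * \<xi> + 2 * pi * \<i> * of_nat k * of_int (- m)"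
      unfolding m by (simp add: algebra_simps)
    then show ?thesis unfolding q_def using per_int[OF inH[OF Re]] by metis
  qed
  have nz: "\<psi> \<xi> \<noteq> 0" if "\<xi> \<in> H" for \<xi>
    using f\<psi>[OF that] exp_in_H[of \<xi>] that R(2) by (metis not_less)
  have holq: "q holomorphic_on ball 0 \<delta> - {0}"
  proof -
    have fd: "q field_differentiable at a" if a: "a \<in> ball 0 \<delta> - {0}" for a
    proof -
      define r where "r = min (norm a) (\<delta> - norm a)"
      have r: "r > 0" using a by (simp add: r_def)
      have sub: "w \<noteq> 0 \<and> norm w < \<delta> \<and> norm (w / a - 1) < 1" if "w \<in> ball a r" for w
      proof -
        have 1: "norm (w - a) < norm a" "norm (w - a) < \<delta> - norm a"
          using that by (auto simp: r_def dist_norm norm_minus_commute)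
        have "w / a - 1 = (w - a) / a" using a by (simp add: field_simps)
        then have "norm (w / a - 1) < 1" using 1 a by (simp add: norm_divide)
        moreover have "norm w < \<delta>" using 1(2) norm_triangle_sub[of w a] by simp
        moreover have "w \<noteq> 0" using 1(1) by auto
        ultimately show ?thesis by blast
      qed
      \<comment> \<open>A logarithm near \<open>a\<close> that also serves when \<open>a\<close>
        lies on the cut of \<open>Ln\<close>, because \<open>w / a\<close> stays close to 1.\<close>
      define l where "l w = Ln a + Ln (w / a)" for w
      have nonpos: "w / a \<notin> \<real>\<^sub>\<le>\<^sub>0" if "w \<in> ball a r" for w
      proof
        assume "w / a \<in> \<real>\<^sub>\<le>\<^sub>0"
        then have "Re (w / a) \<le> 0" by (simp add: complex_nonpos_Reals_iff)
        moreover have "\<bar>Re (w / a - 1)\<bar> \<le> norm (w / a - 1)" by (rule abs_Re_le_cmod)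
        ultimately show False using sub[OF that] by simp
      qed
      have expl: "exp (l w) = w" if "w \<in> ball a r" for w
        using sub[OF that] a by (simp add: l_def exp_add)
      have lH: "- of_nat k * l w \<in> H" if "w \<in> ball a r" for w
      proof (rule inH)
        have "exp (Re (l w)) < \<delta>" using expl[OF that] sub[OF that] by (metis norm_exp_eq_Re)
        then show "Re (l w) < ln \<delta>" using \<delta> by (metis exp_less_cancel_iff exp_ln)
      qed
      have holl: "l holomorphic_on ball a r"
        unfolding l_def using a nonpos by (intro holomorphic_intros) auto
      have "\<psi> \<circ> (\<lambda>w. - of_nat k * l w) holomorphic_on ball a r"
        by (intro holomorphic_on_compose_gen[OF _ hol] holomorphic_intros holl) (use lH in blast)
      then have "(\<lambda>w. inverse (\<psi> (- of_nat k * l w))) holomorphic_on ball a r"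
        unfolding o_def using nz lH by (intro holomorphic_intros) auto
      then have "q holomorphic_on ball a r"
        by (rule holomorphic_transform) (use q_branch expl sub in metis)
      then show ?thesis using r by (meson centre_in_ball holomorphic_on_imp_differentiable_at open_ball)
    qed
    show ?thesis
      by (rule holomorphic_onI, rule field_differentiable_at_within, rule fd)
  qed
  have fq: "f (inverse (q w)) = inverse w ^ k" if "w \<in> ball 0 \<delta> - {0}" for w
  proof -
    have "exp (Re (Ln w)) < \<delta>" using that by (metis DiffD1 DiffD2 exp_Ln insertI1 mem_ball_0 norm_exp_eq_Re)
    then have "Re (Ln w) < ln \<delta>" using \<delta> by (metis exp_less_cancel_iff exp_ln)
    then have "f (inverse (q w)) = exp (- of_nat k * Ln w)" using f\<psi>[OF inH] by (simp add: q_def)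
    also have "\<dots> = inverse (exp (Ln w)) ^ k"
      by (simp add: exp_minus exp_of_nat_mult power_inverse)
    finally show ?thesis using that by simp
  qed
  have qlim: "q \<midarrow>0\<rightarrow> 0"
  proof -
    \<comment> \<open>\<open>f\<close> is bounded on bounded sets, whereas its values at
      \<open>inverse (q w)\<close> are the unbounded \<open>inverse w ^ k\<close>.\<close>
    have "filterlim (\<lambda>w. inverse (q w)) at_infinity (at 0)"
      unfolding filterlim_at_infinity[OF order_refl]
    proof (intro allI impI)
      fix M :: real assume "0 < M"
      have "compact (f ` cball 0 M)" by (intro compact_continuous_image contf) auto
      then have "bounded (f ` cball 0 M)" by (rule compact_imp_bounded)
      then obtain B where "\<forall>y\<in>f ` cball 0 M. norm y \<le> B" unfolding bounded_iff by blast
      then have B: "norm (f z) \<le> B" if "norm z \<le> M" for z using that by simp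
      have "filterlim (\<lambda>w::complex. inverse w ^ k) at_infinity (at 0)"
        using filterlim_compose[OF filterlim_power_at_infinity filterlim_inverse_at_infinity] k
        by (metis not_one_le_zero neq0_conv)
      then have "\<forall>\<^sub>F w in at (0::complex). max 1 (B + 1) \<le> norm (inverse w ^ k)"
        unfolding filterlim_at_infinity[OF order_refl] by (metis less_max_iff_disj zero_less_one)
      moreover have "\<forall>\<^sub>F w in at (0::complex). w \<in> ball 0 \<delta> - {0}"
        using \<delta> eventually_at_in_open[of "ball 0 \<delta>" "0::complex"] by simp
      ultimately show "\<forall>\<^sub>F w in at 0. M \<le> norm (inverse (q w))"
      proof eventually_elim
        case (elim w)
        then have "B < norm (f (inverse (q w)))" using fq by simp
        then show ?case using B by (meson le_less_linear less_le_not_le nless_le)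
      qed
    qed
    then have "((\<lambda>w. inverse (inverse (q w))) \<longlongrightarrow> 0) (at 0)"
      by (rule filterlim_compose[OF tendsto_inverse_0])
    then show ?thesis by simp
  qed
  define Q where "Q w = (if w = 0 then 0 else q w)" for w
  have holQ: "Q holomorphic_on ball 0 \<delta>"
    unfolding Q_def using removable_singularity[OF holq open_ball qlim] .
  have qnz: "q w \<noteq> 0" if "w \<in> ball 0 \<delta> - {0}" for w
  proof -
    have "exp (Ln w) = w" using that by simp
    moreover have "Re (Ln w) < ln \<delta>"
      using that \<delta> by (metis DiffD1 calculation exp_less_cancel_iff exp_ln mem_ball_0 norm_exp_eq_Re)
    ultimately show ?thesis unfolding q_def using nz[OF inH] by simp
  qed
  have nonconst: "\<not> Q constant_on ball 0 \<delta>"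
  proof
    assume "Q constant_on ball 0 \<delta>"
    then have "Q (of_real (\<delta>/2)) = Q 0" using \<delta> by (auto simp: constant_on_def)
    moreover have "complex_of_real (\<delta>/2) \<in> ball 0 \<delta> - {0}" using \<delta> by simp
    ultimately show False using qnz \<delta> by (auto simp: Q_def split: if_splits)
  qed
  \<comment> \<open>\<open>Q\<close> is an open map fixing 0, so every large \<open>z\<close> has
    the form \<open>inverse (Q w)\<close> with \<open>w\<close> small, where the value of
    \<open>f\<close> is known.\<close>
  have "((inverse \<circ> f) \<longlongrightarrow> 0) at_infinity"
    unfolding tendsto_iff eventually_at_infinity
  proof (intro allI impI)
    fix e :: real assume e: "e > 0"
    define \<eta> where "\<eta> = min \<delta> e"
    have "open (Q ` ball 0 \<eta>)"
      by (rule open_mapping_thm[OF holQ open_ball _ open_ball _ nonconst]) (auto simp: \<eta>_def)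
    moreover have "0 \<in> Q ` ball 0 \<eta>" using \<delta> e by (force simp: Q_def \<eta>_def image_iff)
    ultimately obtain s where s: "s > 0" "ball 0 s \<subseteq> Q ` ball 0 \<eta>"
      using open_contains_ball by blast
    have "dist ((inverse \<circ> f) z) 0 < e" if z: "2 / s \<le> norm z" for z
    proof -
      have z0: "z \<noteq> 0" using z s by auto
      have "inverse (norm z) \<le> s / 2" using z s z0 by (simp add: field_simps)
      then have "inverse z \<in> ball 0 s" using s by (simp add: norm_inverse)
      then obtain w where w: "w \<in> ball 0 \<eta>" "inverse z = Q w" using s by blast
      have w0: "w \<noteq> 0" using w z0 by (auto simp: Q_def)
      have "z = inverse (q w)" using w w0 by (metis Q_def inverse_inverse_eq)
      then have "f z = inverse w ^ k" using fq[of w] w w0 by (simp add: \<eta>_def)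
      then have "norm (inverse (f z)) = norm w ^ k" by (simp add: power_inverse norm_power)
      also have "\<dots> \<le> norm w ^ 1" using w \<delta> k by (intro power_decreasing) (auto simp: \<eta>_def)
      also have "\<dots> < e" using w by (simp add: \<eta>_def)
      finally show ?thesis by simp
    qed
    then show "\<exists>b. \<forall>z. b \<le> norm z \<longrightarrow> dist ((inverse \<circ> f) z) 0 < e" by blast
  qed
  then obtain a n where "\<And>z. f z = (\<Sum>i\<le>n. a i * z ^ i)" using pole_at_infinity[OF holf] by blast
  then have "\<forall>z. f z = poly (\<Sum>i\<le>n. monom (a i) i) z" by (simp add: poly_sum poly_monom)
  then show False using transcendental unfolding transcendental_entire_def by blast
qed

text \<open>Suppose \<open>f\<close> maps a circle about 0 into the complement of the disc, and let
  \<mu> be a logarithm of \<open>f\<close> along it. A lift \<psi> of \<open>exp\<close> carries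
  \<mu> back to the circle. As 0 is not in \<open>E\<close>, \<psi> has a logarithm on
  \<open>H\<close>; one turn adds 2 pi i to it, so \<mu> cannot close up. It returns shifted by a
  nonzero multiple of 2 pi i, which makes \<psi> periodic.\<close>

lemma no_circle_in_E:
  assumes \<rho>: "\<rho> > 0" shows "\<not> sphere 0 \<rho> \<subseteq> E"
proof
  assume circ: "sphere 0 \<rho> \<subseteq> E"
  define p where "p t = of_real \<rho> * exp (\<i> * of_real t)" for t :: real
  let ?I = "{0..2 * pi}"
  have p_sphere: "norm (p t) = \<rho>" for t using \<rho> by (simp add: p_def norm_mult)
  have pE: "p t \<in> E" for t using circ p_sphere by (auto simp: subset_iff)
  have contp: "continuous_on A p" for A unfolding p_def by (intro continuous_intros)
  have contfp: "continuous_on ?I (\<lambda>t. f (p t))"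
    using continuous_on_compose[OF contp contf] by (simp add: o_def)
  have fp0: "f (p t) \<noteq> 0" for t using pE[of t] R(1) by auto
  obtain \<mu> where \<mu>: "continuous_on ?I \<mu>" "\<And>t. t \<in> ?I \<Longrightarrow> f (p t) = exp (\<mu> t)"
    using continuous_logarithm_on_contractible[OF contfp convex_imp_contractible[OF convex_real_interval(5)]] fp0
    by metis
  have \<mu>H: "\<mu> t \<in> H" if "t \<in> ?I" for t using pE[of t] \<mu>(2)[OF that] exp_in_H[of "\<mu> t"] by simp
  have I0: "0 \<in> ?I" "2 * pi \<in> ?I" by simp_all
  obtain \<psi> where hol: "\<psi> holomorphic_on H" and \<psi>0: "\<psi> (\<mu> 0) = p 0"
      and f\<psi>: "\<And>\<xi>. \<xi> \<in> H \<Longrightarrow> f (\<psi> \<xi>) = exp \<xi>"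
    using exp_lift[of "\<mu> 0" "p 0"] \<mu>(2)[OF I0(1)] pE[of 0] by auto
  have cont\<psi>: "continuous_on H \<psi>" using hol by (rule holomorphic_on_imp_continuous_on)
  have \<psi>E: "\<psi> \<xi> \<in> E" if "\<xi> \<in> H" for \<xi> using f\<psi>[OF that] exp_in_H[of \<xi>] that by simp
  have cH: "convex H" by (simp add: convex_halfspace_Re_gt)
  have \<psi>\<mu>: "\<psi> (\<mu> t) = p t" if t: "t \<in> ?I" for t
  proof (rule covering_space_lift_unique[OF covering, of "\<lambda>t. \<psi> (\<mu> t)" 0 p ?I "\<lambda>t. f (p t)" t])
    show "(\<lambda>t. f (p t)) \<in> ?I \<rightarrow> - cball 0 R" using pE by (auto simp: not_le)
    show "continuous_on ?I (\<lambda>t. \<psi> (\<mu> t))"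
      using continuous_on_compose2[OF cont\<psi> \<mu>(1)] \<mu>H by blast
    show "(\<lambda>t. \<psi> (\<mu> t)) \<in> ?I \<rightarrow> E" using \<mu>H \<psi>E by blast
    show "f (p x) = f (\<psi> (\<mu> x))" if "x \<in> ?I" for x
      using f\<psi>[OF \<mu>H[OF that]] \<mu>(2)[OF that] by simp
    show "p \<in> ?I \<rightarrow> E" using pE by blast
    show "connected ?I" by (rule connected_Icc)
  qed (rule \<psi>0 contfp contp refl t I0)+
  have nz: "\<psi> \<xi> \<noteq> 0" if "\<xi> \<in> H" for \<xi> using \<psi>E[OF that] R(2) by auto
  obtain L where L: "continuous_on H L" "\<And>\<xi>. \<xi> \<in> H \<Longrightarrow> \<psi> \<xi> = exp (L \<xi>)"
    using continuous_logarithm_on_contractible[OF cont\<psi> convex_imp_contractible[OF cH]] nz by metis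
  \<comment> \<open>Subtracting the angle leaves a continuous lift of the constant \<rho> through
    \<open>exp\<close>, hence a constant.\<close>
  define m where "m t = L (\<mu> t) - \<i> * of_real t" for t
  have contm: "continuous_on ?I m"
    unfolding m_def using continuous_on_compose2[OF L(1) \<mu>(1)] \<mu>H by (intro continuous_intros) blast
  have expm: "exp (m t) = of_real \<rho>" if "t \<in> ?I" for t
  proof -
    have "exp (m t) = p t / exp (\<i> * of_real t)"
      using \<psi>\<mu>[OF that] L(2)[OF \<mu>H[OF that]] by (simp add: m_def exp_diff)
    then show ?thesis by (simp add: p_def)
  qed
  have "m (2 * pi) = m 0"
    by (rule covering_space_lift_unique[OF covering_space_exp_punctured_plane, of m 0 "\<lambda>_. m 0" ?I "\<lambda>_. of_real \<rho>" "2 * pi"])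
       (use contm expm \<rho> in auto)
  then have L2: "L (\<mu> (2 * pi)) = L (\<mu> 0) + 2 * pi * \<i>" by (simp add: m_def algebra_simps)
  have "p (2 * pi) = p 0" by (simp add: p_def exp_eq_1)
  then have "exp (\<mu> (2 * pi)) = exp (\<mu> 0)" using \<mu>(2) I0 by metis
  then obtain N :: int where N: "\<mu> (2 * pi) = \<mu> 0 + of_real (2 * of_int N * pi) * \<i>"
    unfolding exp_eq by auto
  have "N \<noteq> 0" using N L2 by auto
  have perN: "\<psi> (\<xi> + of_real (2 * of_int N * pi) * \<i>) = \<psi> \<xi>" if \<xi>: "\<xi> \<in> H" for \<xi>
  proof (rule covering_space_lift_unique[OF covering, of "\<lambda>\<xi>. \<psi> (\<xi> + of_real (2 * of_int N * pi) * \<i>)" "\<mu> 0" \<psi> H exp \<xi>])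
    have "\<psi> (\<mu> (2 * pi)) = \<psi> (\<mu> 0)" using \<psi>\<mu> I0 \<open>p (2 * pi) = p 0\<close> by metis
    then show "\<psi> (\<mu> 0 + of_real (2 * of_int N * pi) * \<i>) = \<psi> (\<mu> 0)" using N by simp
    have shift: "x + of_real (2 * of_int N * pi) * \<i> \<in> H" if "x \<in> H" for x using that by simp
    show "continuous_on H (\<lambda>\<xi>. \<psi> (\<xi> + of_real (2 * of_int N * pi) * \<i>))"
      by (rule continuous_on_compose2[OF cont\<psi>]) (use shift in \<open>auto intro!: continuous_intros\<close>)
    show "(\<lambda>\<xi>. \<psi> (\<xi> + of_real (2 * of_int N * pi) * \<i>)) \<in> H \<rightarrow> E" using \<psi>E shift by blast
    show "exp x = f (\<psi> (x + of_real (2 * of_int N * pi) * \<i>))" if "x \<in> H" for x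
    proof -
      have "exp (x + of_real (2 * of_int N * pi) * \<i>) = exp x" unfolding exp_eq by auto
      then show ?thesis using f\<psi>[OF shift[OF that]] by simp
    qed
    show "exp x = f (\<psi> x)" if "x \<in> H" for x using f\<psi>[OF that] by simp
    show "continuous_on H exp" by (intro continuous_intros)
    show "exp \<in> H \<rightarrow> - cball 0 R" by (rule exp_H)
    show "\<psi> \<in> H \<rightarrow> E" using \<psi>E by blast
    show "connected H" using cH by (rule convex_connected)
    show "\<mu> 0 \<in> H" using \<mu>H I0 by blast
  qed (use cont\<psi> \<xi> in auto)
  show False
  proof (rule exp_lift_not_periodic[OF hol f\<psi>, of "nat \<bar>N\<bar>"])
    show "1 \<le> nat \<bar>N\<bar>" using \<open>N \<noteq> 0\<close> by simp
    fix \<xi> assume \<xi>: "\<xi> \<in> H"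
    show "\<psi> (\<xi> + 2 * pi * \<i> * of_nat (nat \<bar>N\<bar>)) = \<psi> \<xi>"
    proof (cases "N \<ge> 0")
      case True
      then show ?thesis using perN[OF \<xi>] by (simp add: algebra_simps)
    next
      case False
      define \<eta> where "\<eta> = \<xi> + 2 * pi * \<i> * of_nat (nat \<bar>N\<bar>)"
      have "\<eta> \<in> H" using \<xi> by (simp add: \<eta>_def)
      from perN[OF this] show ?thesis using False by (simp add: \<eta>_def algebra_simps)
    qed
  qed
qed

section \<open>Expansion in the logarithmic metric\<close>

lemma no_large_ball_in_log_E:
  assumes "\<And>x. x \<in> ball b s \<Longrightarrow> exp x \<in> E" shows "s \<le> pi"
proof (rule ccontr)
  assume s: "\<not> s \<le> pi"
  \<comment> \<open>A disc of radius above pi contains the vertical segment from b - i pi to b + i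
    pi, which \<open>exp\<close> wraps once around this circle.\<close>
  have "sphere 0 (exp (Re b)) \<subseteq> E"
  proof
    fix w :: complex assume w: "w \<in> sphere 0 (exp (Re b))"
    define u where "u = Ln (w / exp b)"
    have "norm (w / exp b) = 1" "w / exp b \<noteq> 0" using w by (auto simp: norm_divide)
    then have "Re u = 0" "\<bar>Im u\<bar> \<le> pi" "exp u = w / exp b"
      using mpi_less_Im_Ln[of "w / exp b"] Im_Ln_le_pi[of "w / exp b"] by (auto simp: u_def Re_Ln)
    then have "norm u \<le> pi" by (simp add: cmod_eq_Im)
    then have "b + u \<in> ball b s" using s by (simp add: dist_norm)
    moreover have "exp (b + u) = w" using \<open>exp u = w / exp b\<close> by (simp add: exp_add)
    ultimately show "w \<in> E" using assms by metis
  qed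
  then show False using no_circle_in_E[of "exp (Re b)"] by simp
qed

text \<open>Bloch's theorem, with constant 1/12, finds a disc of radius
  \<open>r * norm (deriv h a) / 12\<close> in the image of \<open>h\<close>, and such a disc has
  radius at most pi.\<close>

lemma deriv_log_bound:
  assumes hol: "h holomorphic_on ball a r" and r: "r > 0" and hE: "\<And>x. x \<in> ball a r \<Longrightarrow> exp (h x) \<in> E"
  shows "r * norm (deriv h a) \<le> 12 * pi"
proof -
  obtain b where "ball b (r * norm (deriv h a) / 12) \<subseteq> h ` ball a r"
    using Bloch[OF hol r order_refl] by blast
  then have "r * norm (deriv h a) / 12 \<le> pi" using hE by (intro no_large_ball_in_log_E[of b]) blast
  then show ?thesis by simp
qed

text \<open>The expansion estimate of Eremenko and Lyubich: the logarithm of a lift of \<open>exp\<close> takes its values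
  in a set without large discs, hence has a small derivative by Bloch's theorem.\<close>

lemma logarithmic_expansion:
  assumes z: "R < norm (f z)"
  shows "norm (f z) * (ln (norm (f z)) - ln R) \<le> 12 * pi * norm (z * deriv f z)"
proof -
  define \<zeta> where "\<zeta> = Ln (f z)"
  have f0: "f z \<noteq> 0" using z R(1) by auto
  then have exp\<zeta>: "exp \<zeta> = f z" by (simp add: \<zeta>_def)
  define \<rho> where "\<rho> = ln (norm (f z)) - ln R"
  have \<rho>: "\<rho> > 0" using z ln_less_cancel_iff[OF R_pos, of "norm (f z)"] R_pos f0 by (simp add: \<rho>_def)
  have Re\<zeta>: "Re \<zeta> = ln (norm (f z))" using f0 by (simp add: \<zeta>_def)
  have sub: "ball \<zeta> \<rho> \<subseteq> H"
  proof
    fix x assume "x \<in> ball \<zeta> \<rho>"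
    then have "\<bar>Re (\<zeta> - x)\<bar> < \<rho>" by (metis abs_Re_le_cmod dist_norm le_less_trans mem_ball)
    then show "x \<in> H" by (simp add: \<rho>_def Re\<zeta>)
  qed
  obtain \<psi> where \<psi>: "\<psi> holomorphic_on H" "\<psi> \<zeta> = z" "\<And>\<xi>. \<xi> \<in> H \<Longrightarrow> f (\<psi> \<xi>) = exp \<xi>"
    using exp_lift[OF exp\<zeta> z] by blast
  have \<psi>E: "\<psi> \<xi> \<in> E" if "\<xi> \<in> H" for \<xi> using \<psi>(3)[OF that] exp_in_H[of \<xi>] that by simp
  have hol: "\<psi> holomorphic_on ball \<zeta> \<rho>" using \<psi>(1) sub holomorphic_on_subset by blast
  have nz: "\<psi> \<xi> \<noteq> 0" if "\<xi> \<in> H" for \<xi> using \<psi>E[OF that] R(2) by auto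
  obtain h where h: "h holomorphic_on ball \<zeta> \<rho>" "\<And>x. x \<in> ball \<zeta> \<rho> \<Longrightarrow> \<psi> x = exp (h x)"
    using contractible_imp_holomorphic_log[OF hol convex_imp_contractible[OF convex_ball]] nz sub by blast
  have bound: "\<rho> * norm (deriv h \<zeta>) \<le> 12 * pi"
  proof (rule deriv_log_bound[OF h(1) \<rho>])
    fix x assume x: "x \<in> ball \<zeta> \<rho>"
    show "exp (h x) \<in> E" using \<psi>E[of x] h(2)[OF x] sub x by auto
  qed
  have \<zeta>b: "\<zeta> \<in> ball \<zeta> \<rho>" using \<rho> by simp
  have dh: "(h has_field_derivative deriv h \<zeta>) (at \<zeta>)" by (rule holomorphic_derivI[OF h(1) open_ball \<zeta>b])
  have expz: "exp (h \<zeta>) = z" using h(2)[OF \<zeta>b] \<psi>(2) by simp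
  have df: "(f has_field_derivative deriv f (exp (h \<zeta>))) (at (exp (h \<zeta>)))"
    by (rule holomorphic_derivI[OF holf open_UNIV UNIV_I])
  \<comment> \<open>Differentiating f(exp(h)) = exp at \<zeta> gives f'(z) z h'(\<zeta>) = f(z), so
    the upper bound on h' becomes a lower bound on z f'(z).\<close>
  have "((\<lambda>x. f (exp (h x))) has_field_derivative deriv f z * (z * deriv h \<zeta>)) (at \<zeta>)"
    using DERIV_chain2[OF df DERIV_fun_exp[OF dh]] expz by simp
  then have "(exp has_field_derivative deriv f z * (z * deriv h \<zeta>)) (at \<zeta>)"
    by (rule has_field_derivative_transform_within_open[OF _ open_ball \<zeta>b])
       (use h(2) \<psi>(3) sub in \<open>metis subsetD\<close>)
  then have "deriv f z * (z * deriv h \<zeta>) = f z"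
    using DERIV_unique[OF DERIV_exp] exp\<zeta> by metis
  then have eq: "norm (f z) = norm (z * deriv f z) * norm (deriv h \<zeta>)"
    by (metis mult.assoc mult.commute norm_mult)
  have "norm (f z) * \<rho> = norm (z * deriv f z) * (\<rho> * norm (deriv h \<zeta>))" using eq by simp
  also have "\<dots> \<le> norm (z * deriv f z) * (12 * pi)" using bound by (intro mult_left_mono) auto
  finally show ?thesis by (simp add: \<rho>_def mult_ac)
qed

text \<open>The logarithmic derivative \<open>D n\<close> of the n-th iterate at \<open>a\<close> at
  least doubles with \<open>n\<close>. But the next iterate is large as well, so the n-th one maps
  the ball into \<open>E\<close>, and the Bloch bound applied to its logarithm gives
  \<open>r * D n \<le> 12 * pi\<close> for every \<open>n\<close>.\<close>

lemma no_ball_with_large_orbits: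
  assumes r: "r > 0" and large: "\<And>x n. x \<in> ball a r \<Longrightarrow> R * exp (24 * pi) < norm ((f ^^ n) x)"
  shows False
proof -
  have Rexp: "R \<le> R * exp (24 * pi)" using R(1) by (simp add: mult_le_cancel_left1)
  have a: "a \<in> ball a r" using r by simp
  have holfn: "(f ^^ n) holomorphic_on UNIV" for n
  proof (induction n)
    case (Suc n)
    have "f \<circ> (f ^^ n) holomorphic_on UNIV"
      using Suc holf holomorphic_on_compose holomorphic_on_subset by blast
    then show ?case by (simp add: o_def)
  qed (simp add: id_def)
  define D where "D n = norm (deriv (f ^^ n) a) / norm ((f ^^ n) a)" for n
  have pos: "0 < norm ((f ^^ n) a)" for n using large[OF a, of n] R(1) Rexp by linarith
  have growth: "2 ^ n * D 0 \<le> D n" for n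
  proof (induction n)
    case (Suc n)
    define w where "w = (f ^^ n) a"
    have fw: "(f ^^ Suc n) a = f w" by (simp add: w_def)
    have big: "R * exp (24 * pi) < norm (f w)" using large[OF a, of "Suc n"] fw by simp
    then have Rw: "R < norm (f w)" using Rexp by linarith
    \<comment> \<open>24 pi is twice the constant 12 pi of the expansion estimate; this is the
      factor 2 per step.\<close>
    have "ln (R * exp (24 * pi)) < ln (norm (f w))"  using big R_pos Rw by (intro ln_less_cancel_iff[THEN iffD2]) auto
    then have "24 * pi \<le> ln (norm (f w)) - ln R" using R(1) by (simp add: ln_mult)
    then have "norm (f w) * (24 * pi) \<le> norm (f w) * (ln (norm (f w)) - ln R)"
      by (intro mult_left_mono) auto
    also have "\<dots> \<le> 12 * pi * norm (w * deriv f w)" by (rule logarithmic_expansion[OF Rw])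
    finally have exp2: "2 * norm (f w) \<le> norm w * norm (deriv f w)" by (simp add: norm_mult)
    have "(f ^^ Suc n has_field_derivative deriv f w * deriv (f ^^ n) a) (at a)"
      using DERIV_chain[OF holomorphic_derivI[OF holf open_UNIV UNIV_I, of "(f ^^ n) a"]
          holomorphic_derivI[OF holfn open_UNIV UNIV_I]] by (simp add: w_def)
    then have "deriv (f ^^ Suc n) a = deriv f w * deriv (f ^^ n) a" by (rule DERIV_imp_deriv)
    then have DS: "D (Suc n) = norm (deriv f w) * norm (deriv (f ^^ n) a) / norm (f w)"
      unfolding D_def fw by (simp add: norm_mult)
    have pw: "norm w > 0" "norm (f w) > 0" using pos[of n] pos[of "Suc n"] fw w_def by auto
    have "2 * D n = 2 * norm (f w) * norm (deriv (f ^^ n) a) / (norm w * norm (f w))"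
      using pw by (simp add: D_def w_def)
    also have "\<dots> \<le> norm w * norm (deriv f w) * norm (deriv (f ^^ n) a) / (norm w * norm (f w))"
      using exp2 pw by (intro divide_right_mono mult_right_mono) auto
    also have "\<dots> = D (Suc n)" using pw by (simp add: DS)
    finally have "2 * D n \<le> D (Suc n)" .
    then show ?case using Suc by simp
  qed simp
  have bounded: "r * D n \<le> 12 * pi" for n
  proof -
    have nz: "(f ^^ n) x \<noteq> 0" if "x \<in> ball a r" for x
    proof -
      have "0 < norm ((f ^^ n) x)" using large[OF that, of n] R_pos Rexp by linarith
      then show ?thesis by simp
    qed
    have "(f ^^ n) holomorphic_on ball a r" using holfn holomorphic_on_subset by blast
    then obtain h where h: "h holomorphic_on ball a r" "\<And>x. x \<in> ball a r \<Longrightarrow> (f ^^ n) x = exp (h x)"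
      using contractible_imp_holomorphic_log[OF _ convex_imp_contractible[OF convex_ball]] nz by blast
    have 1: "r * norm (deriv h a) \<le> 12 * pi"
    proof (rule deriv_log_bound[OF h(1) r])
      fix x assume x: "x \<in> ball a r"
      have "R < norm ((f ^^ Suc n) x)" using large[OF x, of "Suc n"] Rexp by linarith
      then show "exp (h x) \<in> E" using h(2)[OF x] by simp
    qed
    have "((\<lambda>x. exp (h x)) has_field_derivative exp (h a) * deriv h a) (at a)"
      by (rule DERIV_fun_exp[OF holomorphic_derivI[OF h(1) open_ball a]])
    then have "((f ^^ n) has_field_derivative exp (h a) * deriv h a) (at a)"
      by (rule has_field_derivative_transform_within_open[OF _ open_ball a]) (use h(2) in simp)
    then have "deriv (f ^^ n) a = (f ^^ n) a * deriv h a" using h(2)[OF a] by (simp add: DERIV_imp_deriv)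
    then have "D n = norm (deriv h a)" using pos[of n] by (simp add: D_def norm_mult)
    then show ?thesis using 1 by simp
  qed
  have "D 0 > 0" using pos[of 0] by (simp add: D_def id_def)
  then have rD: "r * D 0 > 0" using r by simp
  obtain n where "12 * pi / (r * D 0) < 2 ^ n" using real_arch_pow[of 2] by auto
  then have "12 * pi < r * (2 ^ n * D 0)" using rD by (simp add: field_simps)
  also have "\<dots> \<le> r * D n" using growth r by simp
  finally show False using bounded[of n] by simp
qed

end

subsection \<open>Normal families\<close>

lemma infinite_subsequence:
  assumes "infinite {n::nat. P n}"
  shows "\<exists>q :: nat \<Rightarrow> nat. strict_mono q \<and> (\<forall>n. P (q n))"
  using infinite_enumerate[OF assms] by auto

text \<open>For functions omitting 0 and 1, a bound at one point spreads to all compact subsets of a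
  connected open set (\<open>GPicard3\<close>); Montel's theorem for locally bounded families then
  applies.\<close>

lemma bounded_at_point_omitting_01_subsequence:
  fixes s :: "nat \<Rightarrow> complex \<Rightarrow> complex"
  assumes S: "open S" "connected S" "w \<in> S"
    and hol: "\<And>n. s n holomorphic_on S"
    and omit: "\<And>n z. z \<in> S \<Longrightarrow> s n z \<noteq> 0 \<and> s n z \<noteq> 1"
    and bdd: "\<And>n. norm (s n w) \<le> 1"
  obtains r h where "strict_mono r" "h holomorphic_on S" "loc_unif_converges (s \<circ> r) h S"
proof -
  have "\<exists>B. \<forall>h\<in>range s. \<forall>z\<in>K. norm (h z) \<le> B" if K: "compact K" "K \<subseteq> S" for K
  proof -
    obtain B where "\<And>h z. \<lbrakk>h \<in> range s; z \<in> K\<rbrakk> \<Longrightarrow> norm (h z) \<le> B"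
      by (rule GPicard3[OF S subset_refl, of "range s"]) (use hol omit bdd K in auto)
    then show ?thesis by blast
  qed
  note bounded = this
  show thesis
  proof (rule Montel[OF S(1) _ bounded subset_refl])
    show "h holomorphic_on S" if "h \<in> range s" for h using that hol by auto
    fix h r assume "h holomorphic_on S" "strict_mono (r :: nat \<Rightarrow> nat)"
      "\<And>K. \<lbrakk>compact K; K \<subseteq> S\<rbrakk> \<Longrightarrow> uniform_limit K (s \<circ> r) h sequentially"
    then show thesis by (intro that[of r h]) (simp_all add: loc_unif_converges_def)
  qed
qed

text \<open>If only finitely many members are bounded by 1 at \<open>w\<close>, the reciprocals of
  the others are, and they omit 0 and 1 as well. By Hurwitz the limit of the zero-free reciprocals
  is either identically 0, which means convergence to infinity, or zero-free and can be inverted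
  back.\<close>

lemma Montel_omitting_01:
  fixes s :: "nat \<Rightarrow> complex \<Rightarrow> complex"
  assumes S: "open S" "connected S" "w \<in> S"
    and hol: "\<And>n. s n holomorphic_on S"
    and omit: "\<And>n z. z \<in> S \<Longrightarrow> s n z \<noteq> 0 \<and> s n z \<noteq> 1"
  obtains r where "strict_mono r"
    "(\<exists>h. h holomorphic_on S \<and> loc_unif_converges (s \<circ> r) h S) \<or> loc_unif_converges_infinity (s \<circ> r) S"
proof (cases "infinite {n. norm (s n w) \<le> 1}")
  case True
  from infinite_subsequence[OF this]
  obtain q :: "nat \<Rightarrow> nat" where "strict_mono q \<and> (\<forall>n. norm (s (q n) w) \<le> 1)" ..
  then have q: "strict_mono q" "\<And>n. norm (s (q n) w) \<le> 1" by simp_all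
  obtain r h where "strict_mono r" "h holomorphic_on S" "loc_unif_converges ((\<lambda>n. s (q n)) \<circ> r) h S"
    by (rule bounded_at_point_omitting_01_subsequence[OF S, of "\<lambda>n. s (q n)"])
       (use hol omit q in auto)
  then show thesis
    using that[of "q \<circ> r"] strict_mono_o[OF q(1)] by (auto simp: o_def)
next
  case False
  have "{n. \<not> norm (s n w) \<le> 1} = UNIV - {n. norm (s n w) \<le> 1}" by blast
  then have "infinite {n. \<not> norm (s n w) \<le> 1}" using False by simp
  from infinite_subsequence[OF this]
  obtain q :: "nat \<Rightarrow> nat" where "strict_mono q \<and> (\<forall>n. \<not> norm (s (q n) w) \<le> 1)" ..
  then have q: "strict_mono q" "\<And>n. \<not> norm (s (q n) w) \<le> 1" by simp_all
  define t where "t n z = inverse (s (q n) z)" for n z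
  have t_hol: "t n holomorphic_on S" for n
    unfolding t_def using hol omit by (intro holomorphic_intros) auto
  obtain r h where r: "strict_mono r" and h: "h holomorphic_on S" and conv: "loc_unif_converges (t \<circ> r) h S"
  proof (rule bounded_at_point_omitting_01_subsequence[OF S, of t])
    show "t n holomorphic_on S" for n by (rule t_hol)
    show "t n z \<noteq> 0 \<and> t n z \<noteq> 1" if "z \<in> S" for n z
      using omit[OF that] by (metis inverse_1 inverse_inverse_eq inverse_zero t_def)
    show "norm (t n w) \<le> 1" for n
      using q(2)[of n] by (simp add: t_def norm_inverse inverse_le_1_iff)
  qed blast
  have ul: "uniform_limit K (t \<circ> r) h sequentially" if "compact K" "K \<subseteq> S" for K
    using conv that by (simp add: loc_unif_converges_def)
  have st: "s (q (r n)) z = inverse (t (r n) z)" for n z by (simp add: t_def)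
  have "(\<exists>h. h holomorphic_on S \<and> loc_unif_converges (s \<circ> (q \<circ> r)) h S) \<or>
      loc_unif_converges_infinity (s \<circ> (q \<circ> r)) S"
  proof (cases "\<forall>z\<in>S. h z = 0")
    case True
    have "\<forall>\<^sub>F n in sequentially. \<forall>z\<in>K. B < norm ((s \<circ> (q \<circ> r)) n z)"
      if K: "compact K" "K \<subseteq> S" for K B
    proof -
      define e where "e = inverse (\<bar>B\<bar> + 1)"
      have e: "e > 0" by (simp add: e_def)
      from uniform_limitD[OF ul[OF K] e] show ?thesis
      proof eventually_elim
        case (elim n)
        show ?case
        proof
          fix z assume z: "z \<in> K"
          then have "norm (t (r n) z) < e" using elim True K by (auto simp: dist_norm subset_iff)
          moreover have "t (r n) z \<noteq> 0" using omit z K by (auto simp: t_def subset_iff)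
          ultimately have "inverse e < norm (inverse (t (r n) z))"
            by (simp add: norm_inverse less_imp_inverse_less)
          then show "B < norm ((s \<circ> (q \<circ> r)) n z)" using st by (simp add: e_def)
        qed
      qed
    qed
    then show ?thesis unfolding loc_unif_converges_infinity_def by blast
  next
    case False
    have nz: "h z \<noteq> 0" if z: "z \<in> S" for z
    proof (cases "h constant_on S")
      case True
      then show ?thesis using False z unfolding constant_on_def by metis
    next
      case nc: False
      show ?thesis
      proof (rule Hurwitz_no_zeros[OF S(1,2) _ h ul nc _ z])
        show "(t \<circ> r) n holomorphic_on S" for n using t_hol by simp
        show "(t \<circ> r) n x \<noteq> 0" if "x \<in> S" for n x using omit[OF that] by (simp add: t_def)
      qed
    qed
    have "uniform_limit K (s \<circ> (q \<circ> r)) (inverse \<circ> h) sequentially"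
      if K: "compact K" "K \<subseteq> S" for K
    proof (cases "K = {}")
      case False
      have "continuous_on K (\<lambda>z. norm (h z))"
        using h K by (intro continuous_intros holomorphic_on_imp_continuous_on) (rule holomorphic_on_subset)
      then obtain z0 where z0: "z0 \<in> K" "\<And>z. z \<in> K \<Longrightarrow> norm (h z0) \<le> norm (h z)"
        using continuous_attains_inf[OF K(1) False] by blast
      have "0 < norm (h z0)" using nz z0 K by auto
      then have "uniform_limit K (\<lambda>n z. inverse ((t \<circ> r) n z)) (inverse \<circ> h) sequentially"
        using uniform_lim_inverse[OF ul[OF K] z0(2)] by blast
      then show ?thesis by (simp add: t_def o_def)
    qed (simp add: uniform_limit_iff)
    moreover have "inverse \<circ> h holomorphic_on S"
      unfolding o_def using h nz by (intro holomorphic_intros) auto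
    ultimately show ?thesis unfolding loc_unif_converges_def by blast
  qed
  then show thesis using that[of "q \<circ> r"] strict_mono_o[OF q(1) r] by blast
qed

text \<open>A ball is its own single component, so the componentwise alternative in
  \<open>normal_family_on\<close> reduces to the dichotomy for 0 and 1, transported by the affine
  map taking \<open>a\<close>, \<open>b\<close> to 0, 1.\<close>

lemma normal_family_on_ball_omitting:
  assumes hol: "\<And>h. h \<in> \<F> \<Longrightarrow> h holomorphic_on ball c \<rho>"
    and omit: "\<And>h z. h \<in> \<F> \<Longrightarrow> z \<in> ball c \<rho> \<Longrightarrow> h z \<noteq> a \<and> h z \<noteq> b"
    and ab: "a \<noteq> b" and \<rho>: "\<rho> > 0"
  shows "normal_family_on \<F> (ball c \<rho>)"
  unfolding normal_family_on_def
proof (intro allI impI)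
  fix s :: "nat \<Rightarrow> complex \<Rightarrow> complex" assume s: "range s \<subseteq> \<F>"
  let ?B = "ball c \<rho>"
  define t where "t n z = (s n z - a) / (b - a)" for n z
  have s_eq: "s n z = a + (b - a) * t n z" for n z using ab by (simp add: t_def)
  obtain r where r: "strict_mono r"
    and conv: "(\<exists>h. h holomorphic_on ?B \<and> loc_unif_converges (t \<circ> r) h ?B) \<or> loc_unif_converges_infinity (t \<circ> r) ?B"
  proof (rule Montel_omitting_01[OF open_ball, of c \<rho> c t])
    show "connected ?B" by simp
    show "c \<in> ?B" using \<rho> by simp
    show "t n holomorphic_on ?B" for n
      unfolding t_def using hol s ab by (intro holomorphic_intros) auto
    show "t n z \<noteq> 0 \<and> t n z \<noteq> 1" if "z \<in> ?B" for n z
      using omit[of "s n" z] s ab that by (auto simp: t_def)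
  qed blast
  have "(\<exists>h. h holomorphic_on ?B \<and> loc_unif_converges (s \<circ> r) h ?B) \<or> loc_unif_converges_infinity (s \<circ> r) ?B"
    using conv
  proof
    assume "\<exists>h. h holomorphic_on ?B \<and> loc_unif_converges (t \<circ> r) h ?B"
    then obtain h where h: "h holomorphic_on ?B" and ul: "loc_unif_converges (t \<circ> r) h ?B" by blast
    have "uniform_limit K (s \<circ> r) (\<lambda>z. a + (b - a) * h z) sequentially" if K: "compact K" "K \<subseteq> ?B" for K
    proof -
      have "uniform_limit K (t \<circ> r) h sequentially" using ul K by (simp add: loc_unif_converges_def)
      then have "uniform_limit K (\<lambda>n z. a + (b - a) * (t \<circ> r) n z) (\<lambda>z. a + (b - a) * h z) sequentially"
        by (intro uniform_limit_add uniform_limit_const bounded_linear.uniform_limit[OF bounded_linear_mult_right])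
      moreover have "(\<lambda>n z. a + (b - a) * (t \<circ> r) n z) = s \<circ> r" by (simp add: fun_eq_iff s_eq)
      ultimately show ?thesis by simp
    qed
    moreover have "(\<lambda>z. a + (b - a) * h z) holomorphic_on ?B" by (intro holomorphic_intros h)
    ultimately show ?thesis unfolding loc_unif_converges_def by blast
  next
    assume inf: "loc_unif_converges_infinity (t \<circ> r) ?B"
    have "\<forall>\<^sub>F n in sequentially. \<forall>z\<in>K. B < norm ((s \<circ> r) n z)" if K: "compact K" "K \<subseteq> ?B" for K B
    proof -
      have "\<forall>\<^sub>F n in sequentially. \<forall>z\<in>K. (B + norm a) / norm (b - a) < norm ((t \<circ> r) n z)"
        using inf K unfolding loc_unif_converges_infinity_def by blast
      then show ?thesis
      proof eventually_elim
        case (elim n)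
        show ?case
        proof
          fix z assume "z \<in> K"
          then have "(B + norm a) / norm (b - a) < norm (t (r n) z)" using elim by simp
          then have "B + norm a < norm ((b - a) * t (r n) z)"
            using ab by (simp add: norm_mult divide_less_eq mult.commute)
          also have "\<dots> \<le> norm (s (r n) z) + norm a"
            using norm_triangle_ineq4[of "s (r n) z" a] by (simp add: s_eq)
          finally show "B < norm ((s \<circ> r) n z)" by simp
        qed
      qed
    qed
    then show ?thesis unfolding loc_unif_converges_infinity_def by blast
  qed
  moreover have "components ?B = {?B}" using \<rho> by (simp add: components_eq_sing_iff)
  ultimately show "\<exists>r. strict_mono r \<and> (\<forall>C\<in>components ?B.
      (\<exists>h. h holomorphic_on C \<and> loc_unif_converges (s \<circ> r) h C) \<or> loc_unif_converges_infinity (s \<circ> r) C)"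
    using r by auto
qed

lemma invariant_open_subset_fatou_set:
  assumes U: "open U" and hol: "\<And>h. h \<in> \<F> \<Longrightarrow> h holomorphic_on UNIV"
    and inv: "\<And>h. h \<in> \<F> \<Longrightarrow> h ` U \<subseteq> U" and ab: "a \<notin> U" "b \<notin> U" "a \<noteq> b"
  shows "U \<subseteq> fatou_set \<F>"
proof
  fix z assume "z \<in> U"
  then obtain \<rho> where \<rho>: "\<rho> > 0" "ball z \<rho> \<subseteq> U" using U open_contains_ball by blast
  have "normal_family_on \<F> (ball z \<rho>)"
  proof (rule normal_family_on_ball_omitting[OF _ _ ab(3) \<rho>(1)])
    fix h assume h: "h \<in> \<F>"
    show "h holomorphic_on ball z \<rho>" using hol[OF h] holomorphic_on_subset by blast
    fix x assume "x \<in> ball z \<rho>"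
    then have "h x \<in> U" using inv[OF h] \<rho>(2) by blast
    then show "h x \<noteq> a \<and> h x \<noteq> b" using ab by blast
  qed
  then show "z \<in> fatou_set \<F>" unfolding fatou_set_def using \<rho>(1) by (auto intro!: exI[of _ "ball z \<rho>"])
qed

lemma open_fatou_set: "open (fatou_set \<F>)"
  unfolding fatou_set_def by blast

lemma fatou_set_antimono:
  assumes "\<F> \<subseteq> \<G>" shows "fatou_set \<G> \<subseteq> fatou_set \<F>"
proof -
  have "normal_family_on \<F> U" if "normal_family_on \<G> U" for U
    using assms that unfolding normal_family_on_def by (meson order_trans)
  then show ?thesis unfolding fatou_set_def by blast
qed

subsection \<open>Escaping points and the Fatou set\<close>

lemma singular_values_bounded_if:
  assumes "transcendental_entire f" "bounded (sing_inverse f)"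
  obtains R where "singular_values_bounded f R"
proof -
  obtain B where B: "\<forall>w\<in>sing_inverse f. norm w \<le> B"
    using assms(2) unfolding bounded_iff by blast
  have sub: "critical_values f \<subseteq> sing_inverse f" "asymptotic_values f \<subseteq> sing_inverse f"
    using closure_subset[of "critical_values f \<union> asymptotic_values f"]
    unfolding sing_inverse_def by blast+
  define R where "R = max B (max 1 (norm (f 0)))"
  have "singular_values_bounded f R"
  proof
    show "transcendental_entire f" by fact
    show "1 \<le> R" "norm (f 0) \<le> R" by (simp_all add: R_def)
    show "deriv f z \<noteq> 0" if "R < norm (f z)" for z
    proof
      assume "deriv f z = 0"
      then have "norm (f z) \<le> B" using B sub by (auto simp: critical_values_def)
      then show False using that by (simp add: R_def)
    qed
    show "norm w \<le> R" if "w \<in> asymptotic_values f" for w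
      using B sub that by (force simp: R_def)
  qed
  then show thesis by (rule that)
qed

lemma open_image_funpow:
  assumes "transcendental_entire f" "open U" shows "open ((f ^^ n) ` U)"
proof (induction n)
  case (Suc n)
  then show ?case using open_image_entire[OF assms(1) Suc] by (simp add: image_comp)
qed (simp add: assms)

text \<open>Escape at \<open>z\<close> rules out a holomorphic limit on the component of
  \<open>z\<close>, so every sequence of iterates has a subsequence tending to infinity uniformly on
  \<open>cball z \<rho>\<close>. Iterates that fail a fixed bound there cannot form an infinite
  sequence.\<close>

lemma escaping_orbit_locally_uniform:
  assumes U: "open U" "normal_family_on (iterates f) U" "z \<in> U" and esc: "z \<in> escaping_set f"
  obtains \<rho> where "\<rho> > 0" "\<And>B. \<forall>\<^sub>F n in sequentially. \<forall>x\<in>cball z \<rho>. B < norm ((f ^^ n) x)"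
proof -
  define C where "C = connected_component_set U z"
  have C: "C \<in> components U" "open C" "z \<in> C"
    using U by (simp_all add: C_def componentsI open_connected_component)
  obtain \<rho> where \<rho>: "\<rho> > 0" "cball z \<rho> \<subseteq> C" using C open_contains_cball by blast
  have "\<forall>\<^sub>F n in sequentially. \<forall>x\<in>cball z \<rho>. B < norm ((f ^^ n) x)" for B
  proof (rule ccontr)
    assume "\<not> (\<forall>\<^sub>F n in sequentially. \<forall>x\<in>cball z \<rho>. B < norm ((f ^^ n) x))"
    then have freq: "\<And>N. \<exists>n\<ge>N. \<not> (\<forall>x\<in>cball z \<rho>. B < norm ((f ^^ n) x))"
      unfolding eventually_sequentially by blast
    \<comment> \<open>The condition \<open>n \<ge> 1\<close> is kept because \<open>iterates\<close>
      excludes the identity.\<close>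
    have "infinite {n. n \<ge> 1 \<and> \<not> (\<forall>x\<in>cball z \<rho>. B < norm ((f ^^ n) x))}"
      unfolding infinite_nat_iff_unbounded_le
    proof
      fix m show "\<exists>n\<ge>m. n \<in> {n. n \<ge> 1 \<and> \<not> (\<forall>x\<in>cball z \<rho>. B < norm ((f ^^ n) x))}"
        using freq[of "max m 1"] by auto
    qed
    from infinite_subsequence[OF this]
    obtain q :: "nat \<Rightarrow> nat" where "strict_mono q \<and> (\<forall>n. q n \<ge> 1 \<and> \<not> (\<forall>x\<in>cball z \<rho>. B < norm ((f ^^ q n) x)))" ..
    then have q: "strict_mono q" "\<And>n. q n \<ge> 1" "\<And>n. \<not> (\<forall>x\<in>cball z \<rho>. B < norm ((f ^^ q n) x))" by auto
    define s where "s n = f ^^ q n" for n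
    have "range s \<subseteq> iterates f" using q(2) by (auto simp: s_def iterates_def)
    then obtain r where r: "strict_mono r"
      and conv: "(\<exists>h. h holomorphic_on C \<and> loc_unif_converges (s \<circ> r) h C) \<or> loc_unif_converges_infinity (s \<circ> r) C"
      using U(2) C(1) unfolding normal_family_on_def by meson
    have "filterlim (\<lambda>n. (f ^^ q (r n)) z) at_infinity sequentially"
      using esc filterlim_compose[OF _ filterlim_subseq[OF strict_mono_o[OF q(1) r]]]
      unfolding escaping_set_def o_def by blast
    then have to_inf: "filterlim (\<lambda>n. (s \<circ> r) n z) at_infinity sequentially" by (simp add: s_def)
    from conv show False
    proof
      assume "\<exists>h. h holomorphic_on C \<and> loc_unif_converges (s \<circ> r) h C"
      then obtain h where "loc_unif_converges (s \<circ> r) h C" by blast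
      then have "uniform_limit {z} (s \<circ> r) h sequentially"
        using C(3) finite_imp_compact[of "{z}"] unfolding loc_unif_converges_def by blast
      then have "(\<lambda>n. (s \<circ> r) n z) \<longlonglongrightarrow> h z" by simp
      then show False using not_tendsto_and_filterlim_at_infinity[OF _ _ to_inf] by simp
    next
      assume "loc_unif_converges_infinity (s \<circ> r) C"
      moreover have "compact (cball z \<rho>) \<and> cball z \<rho> \<subseteq> C" using \<rho>(2) by simp
      ultimately have "\<forall>\<^sub>F n in sequentially. \<forall>x\<in>cball z \<rho>. B < norm ((s \<circ> r) n x)"
        unfolding loc_unif_converges_infinity_def by (elim allE impE)
      then obtain n where "\<forall>x\<in>cball z \<rho>. B < norm ((s \<circ> r) n x)"
        by (rule eventually_happens'[OF sequentially_bot, THEN exE])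
      then show False using q(3)[of "r n"] by (simp add: s_def)
    qed
  qed
  then show thesis using that \<rho>(1) by blast
qed

text \<open>At an escaping Fatou point a whole disc escapes uniformly. Its image under a late
  iterate contains a ball whose points stay beyond \<open>R * exp (24 * pi)\<close> from time 0 on,
  which the expansion forbids.\<close>

lemma escaping_set_disjoint_fatou_set:
  assumes f: "transcendental_entire f" and bdd: "bounded (sing_inverse f)"
  shows "escaping_set f \<inter> fatou_set (iterates f) = {}"
proof (rule ccontr)
  assume "escaping_set f \<inter> fatou_set (iterates f) \<noteq> {}"
  then obtain z U where z: "z \<in> escaping_set f" and U: "open U" "normal_family_on (iterates f) U" "z \<in> U"
    unfolding fatou_set_def by blast
  obtain \<rho> where \<rho>: "\<rho> > 0" "\<And>B. \<forall>\<^sub>F n in sequentially. \<forall>x\<in>cball z \<rho>. B < norm ((f ^^ n) x)"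
    using escaping_orbit_locally_uniform[OF U z] by blast
  obtain R where R: "singular_values_bounded f R" using singular_values_bounded_if[OF f bdd] by blast
  obtain N where N: "\<And>n x. n \<ge> N \<Longrightarrow> x \<in> cball z \<rho> \<Longrightarrow> R * exp (24 * pi) < norm ((f ^^ n) x)"
    using \<rho>(2)[of "R * exp (24 * pi)"] unfolding eventually_sequentially by blast
  have "open ((f ^^ N) ` ball z \<rho>)" by (rule open_image_funpow[OF f open_ball])
  moreover have "(f ^^ N) z \<in> (f ^^ N) ` ball z \<rho>" using \<rho>(1) by simp
  ultimately obtain r where r: "r > 0" "ball ((f ^^ N) z) r \<subseteq> (f ^^ N) ` ball z \<rho>"
    using open_contains_ball by blast
  show False
  proof (rule singular_values_bounded.no_ball_with_large_orbits[OF R r(1)])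
    fix y n assume "y \<in> ball ((f ^^ N) z) r"
    then obtain x where x: "x \<in> ball z \<rho>" "y = (f ^^ N) x" using r(2) by blast
    have "R * exp (24 * pi) < norm ((f ^^ (n + N)) x)" using x by (intro N) auto
    then show "R * exp (24 * pi) < norm ((f ^^ n) y)" using x by (simp add: funpow_add)
  qed
qed

section \<open>Invariance properties of the escaping set\<close>

lemma funpow_mem_escaping_set:
  assumes "z \<in> escaping_set f" shows "(f ^^ n) z \<in> escaping_set f"
proof -
  have "filterlim (\<lambda>m. (f ^^ (m + n)) z) at_infinity sequentially"
    using assms filterlim_compose[OF _ filterlim_add_const_nat_at_top] unfolding escaping_set_def by blast
  then show ?thesis by (simp add: escaping_set_def funpow_add)
qed

lemma escaping_set_two_points:
  assumes "transcendental_entire f"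
  obtains a b where "a \<in> escaping_set f" "b \<in> escaping_set f" "a \<noteq> b"
proof -
  obtain z where z: "z \<in> escaping_set f" using escaping_set_nonempty[OF assms] by blast
  then have "\<forall>\<^sub>F n in sequentially. norm z + 1 \<le> norm ((f ^^ n) z)"
    unfolding escaping_set_def filterlim_at_infinity[OF order_refl] by (simp add: add_nonneg_pos)
  then obtain n where "norm z + 1 \<le> norm ((f ^^ n) z)"
    using eventually_happens' sequentially_bot by blast
  then have "(f ^^ n) z \<noteq> z" by auto
  then show thesis using that z funpow_mem_escaping_set by metis
qed

lemma escaping_set_preimage:
  assumes "f z \<in> escaping_set f" shows "z \<in> escaping_set f"
proof -
  have "filterlim (\<lambda>n. (f ^^ Suc n) z) at_infinity sequentially"
    using assms by (simp add: escaping_set_def funpow_swap1)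
  then show ?thesis unfolding escaping_set_def using filterlim_sequentially_Suc by blast
qed

text \<open>Slope and offset are read off as \<open>\<phi> 1 - \<phi> 0\<close> and
  \<open>\<phi> 0\<close>, so convergence at two points controls them. Slopes shrinking to 0 or
  offsets growing without bound would leave no subsequence with a nondegenerate limit.\<close>

lemma precompact_affine_lower_bound:
  assumes \<Phi>: "precompact_affine \<Phi>"
  obtains c d where "c > 0" "\<And>\<phi> z. \<phi> \<in> \<Phi> \<Longrightarrow> c * norm z - d \<le> norm (\<phi> z)"
proof -
  have "\<exists>n::nat. \<forall>\<phi>\<in>\<Phi>. inverse (real (Suc n)) \<le> norm (\<phi> 1 - \<phi> 0) \<and> norm (\<phi> 0) \<le> real n"
  proof (rule ccontr)
    assume "\<not> ?thesis"
    then obtain s where s: "\<And>n. s n \<in> \<Phi>"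
      and bad: "\<And>n. \<not> (inverse (real (Suc n)) \<le> norm (s n 1 - s n 0) \<and> norm (s n 0) \<le> real n)"
      by metis
    obtain r \<phi> where r: "strict_mono r" and \<phi>: "\<phi> \<in> affine_maps" and conv: "loc_unif_converges (s \<circ> r) \<phi> UNIV"
      using \<Phi> s unfolding precompact_affine_def by blast
    have lim: "(\<lambda>n. s (r n) x) \<longlonglongrightarrow> \<phi> x" for x
    proof -
      have "uniform_limit {x} (s \<circ> r) \<phi> sequentially"
        using conv finite_imp_compact[of "{x}"] unfolding loc_unif_converges_def by blast
      then show ?thesis by simp
    qed
    have rtop: "filterlim r at_top sequentially" by (rule filterlim_subseq[OF r])
    have "\<phi> 1 - \<phi> 0 \<noteq> 0" using \<phi> by (auto simp: affine_maps_def)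
    moreover have "(\<lambda>n. norm (s (r n) 1 - s (r n) 0)) \<longlonglongrightarrow> norm (\<phi> 1 - \<phi> 0)"
      by (intro tendsto_intros lim)
    moreover have "(\<lambda>n. inverse (real (Suc (r n)))) \<longlonglongrightarrow> 0"
      by (rule filterlim_compose[OF LIMSEQ_inverse_real_of_nat rtop])
    ultimately have "\<forall>\<^sub>F n in sequentially. 0 < norm (s (r n) 1 - s (r n) 0) - inverse (real (Suc (r n)))"
      by (intro order_tendstoD(1)[OF tendsto_diff]) auto
    then have 1: "\<forall>\<^sub>F n in sequentially. inverse (real (Suc (r n))) < norm (s (r n) 1 - s (r n) 0)"
      by eventually_elim simp
    have "\<forall>\<^sub>F n in sequentially. norm (s (r n) 0) < norm (\<phi> 0) + 1"
      by (rule order_tendstoD(2)[OF tendsto_norm[OF lim]]) simp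
    moreover have "\<forall>\<^sub>F n in sequentially. norm (\<phi> 0) + 1 \<le> real (r n)"
      using filterlim_compose[OF filterlim_real_sequentially rtop] unfolding filterlim_at_top by blast
    ultimately have "\<forall>\<^sub>F n in sequentially. False"
      using 1
    proof eventually_elim
      case (elim n)
      then show ?case using bad[of "r n"] by linarith
    qed
    then show False by simp
  qed
  then obtain n where n: "\<And>\<phi>. \<phi> \<in> \<Phi> \<Longrightarrow> inverse (real (Suc n)) \<le> norm (\<phi> 1 - \<phi> 0) \<and> norm (\<phi> 0) \<le> real n"
    by blast
  have "inverse (real (Suc n)) * norm z - real n \<le> norm (\<phi> z)" if \<phi>: "\<phi> \<in> \<Phi>" for \<phi> z
  proof -
    obtain a b where ab: "\<phi> = (\<lambda>z. a * z + b)" using \<Phi> \<phi> by (auto simp: precompact_affine_def affine_maps_def)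
    then have "inverse (real (Suc n)) \<le> norm a" "norm b \<le> real n" using n[OF \<phi>] by auto
    then have "inverse (real (Suc n)) * norm z - real n \<le> norm (a * z) - norm b"
      unfolding norm_mult by (intro diff_mono mult_right_mono) auto
    also have "\<dots> \<le> norm (\<phi> z)" using norm_diff_ineq[of "a * z" b] by (simp add: ab)
    finally show ?thesis .
  qed
  then show thesis using that[of "inverse (real (Suc n))" "real n"] by simp
qed

lemma escaping_set_preimage_nearly_commuting:
  assumes \<Phi>: "precompact_affine \<Phi>"
    and comm: "\<And>n. n \<ge> 1 \<Longrightarrow> \<exists>\<phi>\<in>\<Phi>. f \<circ> (g ^^ n) = \<phi> \<circ> (g ^^ n) \<circ> f"
    and f: "continuous_on UNIV f" and z: "f z \<in> escaping_set g"
  shows "z \<in> escaping_set g"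
proof -
  obtain c d where c: "c > 0" and cd: "\<And>\<phi> z. \<phi> \<in> \<Phi> \<Longrightarrow> c * norm z - d \<le> norm (\<phi> z)"
    using precompact_affine_lower_bound[OF \<Phi>] by blast
  have low: "c * norm ((g ^^ n) (f z)) - d \<le> norm (f ((g ^^ n) z))" if "n \<ge> 1" for n
  proof -
    obtain \<phi> where \<phi>: "\<phi> \<in> \<Phi>" "f \<circ> (g ^^ n) = \<phi> \<circ> (g ^^ n) \<circ> f" using comm[OF \<open>n \<ge> 1\<close>] by blast
    have "f ((g ^^ n) z) = \<phi> ((g ^^ n) (f z))" using fun_cong[OF \<phi>(2), of z] by simp
    then show ?thesis using cd[OF \<phi>(1)] by simp
  qed
  have "filterlim (\<lambda>n. (g ^^ n) z) at_infinity sequentially"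
    unfolding filterlim_at_infinity[OF order_refl]
  proof (intro allI impI)
    fix M :: real
    have "compact (f ` cball 0 M)"
      by (intro compact_continuous_image continuous_on_subset[OF f]) auto
    then have "bounded (f ` cball 0 M)" by (rule compact_imp_bounded)
    then obtain B where "\<forall>y\<in>f ` cball 0 M. norm y \<le> B" unfolding bounded_iff by blast
    then have B: "norm (f x) \<le> B" if "norm x \<le> M" for x using that by simp
    have "filterlim (\<lambda>n. (g ^^ n) (f z)) at_infinity sequentially" using z by (simp add: escaping_set_def)
    \<comment> \<open>Beyond \<open>(B + d + 1) / c\<close> the affine lower bound exceeds
      \<open>B\<close>, the bound of \<open>f\<close> on \<open>cball 0 M\<close>, so the point of
      the orbit of \<open>z\<close> lies outside that disc.\<close>
    then have "\<forall>\<^sub>F n in sequentially. max 1 ((B + d + 1) / c) \<le> norm ((g ^^ n) (f z))"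
      unfolding filterlim_at_infinity[OF order_refl] by (metis less_max_iff_disj zero_less_one)
    then show "\<forall>\<^sub>F n in sequentially. M \<le> norm ((g ^^ n) z)"
      using eventually_ge_at_top[of 1]
    proof eventually_elim
      case (elim n)
      then have "(B + d + 1) / c \<le> norm ((g ^^ n) (f z))" by simp
      then have "B + d + 1 \<le> c * norm ((g ^^ n) (f z))" using c by (simp add: divide_le_eq mult.commute)
      then have "B < norm (f ((g ^^ n) z))" using low[of n] elim by linarith
      then show ?case using B[of "(g ^^ n) z"] by linarith
    qed
  qed
  then show ?thesis by (simp add: escaping_set_def)
qed

lemma iterates_subset_generated_semigroup:
  assumes "g \<in> S" shows "iterates g \<subseteq> generated_semigroup S"
proof -
  have "g ^^ Suc n \<in> generated_semigroup S" for n
  proof (induction n)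
    case 0 show ?case using generator[OF assms] by simp
  next
    case (Suc n)
    show ?case using generated_semigroup.comp[OF generator[OF assms] Suc] by (simp only: funpow.simps(2)[of "Suc n"])
  qed
  then show ?thesis unfolding iterates_def by (auto simp: Suc_le_eq gr0_conv_Suc)
qed

lemma fatou_set_nearly_abelian:
  assumes f: "transcendental_entire f" and g: "transcendental_entire g"
    and G: "G = generated_semigroup {f, g}" and na: "nearly_abelian G"
    and bdd: "bounded (sing_inverse g)"
  shows "fatou_set G = fatou_set (iterates g)"
proof
  have sub: "iterates g \<subseteq> G" unfolding G by (rule iterates_subset_generated_semigroup) simp
  then show "fatou_set G \<subseteq> fatou_set (iterates g)" by (rule fatou_set_antimono)
  define U where "U = interior (- escaping_set g)"
  have "fatou_set (iterates g) \<subseteq> U"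
    unfolding U_def using escaping_set_disjoint_fatou_set[OF g bdd] open_fatou_set
    by (intro interior_maximal) auto
  also have "U \<subseteq> fatou_set G"
  proof -
    obtain a b where ab: "a \<in> escaping_set g" "b \<in> escaping_set g" "a \<noteq> b"
      using escaping_set_two_points[OF g] by blast
    obtain \<Phi> where \<Phi>: "precompact_affine \<Phi>" "\<forall>h\<in>G. \<forall>k\<in>G. \<exists>\<phi>\<in>\<Phi>. h \<circ> k = \<phi> \<circ> k \<circ> h"
      using na unfolding nearly_abelian_def by blast
    have fG: "f \<in> G" unfolding G by (simp add: generator)
    have "\<exists>\<phi>\<in>\<Phi>. f \<circ> (g ^^ n) = \<phi> \<circ> (g ^^ n) \<circ> f" if "n \<ge> 1" for n
      using \<Phi>(2) fG sub that unfolding iterates_def by blast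
    moreover have "continuous_on UNIV f"
      using f by (simp add: transcendental_entire_def holomorphic_on_imp_continuous_on)
    ultimately have pf: "f z \<in> escaping_set g \<Longrightarrow> z \<in> escaping_set g" for z
      using escaping_set_preimage_nearly_commuting[OF \<Phi>(1), of f g z] by blast
    have U_inv: "h ` U \<subseteq> U" if "transcendental_entire h" "\<And>z. h z \<in> escaping_set g \<Longrightarrow> z \<in> escaping_set g" for h
    proof -
      have "open (h ` U)" using open_image_entire[OF that(1)] by (simp add: U_def)
      moreover have "h ` U \<subseteq> - escaping_set g" using that(2) interior_subset unfolding U_def by blast
      ultimately show ?thesis unfolding U_def by (intro interior_maximal)
    qed
    have "h ` U \<subseteq> U \<and> h holomorphic_on UNIV" if "h \<in> G" for h
      using that unfolding G
    proof induction
      case (generator h)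
      then show ?case
        using U_inv[OF f pf] U_inv[OF g escaping_set_preimage[of g]] f g by (auto simp: transcendental_entire_def)
    next
      case (comp h k)
      have "h holomorphic_on range k" using comp.IH(1) holomorphic_on_subset by blast
      then have "h \<circ> k holomorphic_on UNIV" using comp.IH(2) holomorphic_on_compose by blast
      moreover have "(h \<circ> k) ` U \<subseteq> U" using comp.IH by (simp add: image_subset_iff)
      ultimately show ?case by blast
    qed
    then show ?thesis
      using ab interior_subset[of "- escaping_set g"]
      by (intro invariant_open_subset_fatou_set[of U G a b]) (auto simp: U_def)
  qed
  finally show "fatou_set (iterates g) \<subseteq> fatou_set G" .
qed

theorem theorem5:
  fixes f g :: "complex \<Rightarrow> complex" and G :: "(complex \<Rightarrow> complex) set"
  assumes "transcendental_entire f" and "transcendental_entire g"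
    and "G = generated_semigroup {f, g}"
    and "nearly_abelian G"
    and "bounded (sing_inverse f)" and "bounded (sing_inverse g)"
  shows "julia_set G = julia_set (iterates f) \<and> julia_set (iterates f) = julia_set (iterates g)"
proof -
  have "fatou_set G = fatou_set (iterates g)"
    using assms by (intro fatou_set_nearly_abelian[of f g])
  moreover have "fatou_set G = fatou_set (iterates f)"
    using assms by (intro fatou_set_nearly_abelian[of g f]) (simp_all add: insert_commute)
  ultimately show ?thesis by (simp add: julia_set_def)
qed

end
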